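(* Let $X=(X_t)_{t\ge 0}$ be a conservative regular one-dimensional diffusion on an interval $I\subseteq\mathbb{R}$ with $0\in I$, with speed measure $m$, Green kernel $G_\lambda$, and first hitting time $H_0$ of $0$. Let $I^+:=I\cap[0,\infty)$, let $A_t:=\mathrm{Leb}\{s\in[0,t]:X_s\ge 0\}$, let $\lambda>0$, $r\ge 0$, and let $T\sim\mathrm{Exp}(\lambda)$ be an exponentially distributed random variable (with rate $\lambda$) independent of $X$. Then, for $x\in I$ with $x>0$, $$\mathbf{E}_x(\mathrm{e}^{-rA_T})=\frac{\lambda}{\lambda+r}-\left(\frac{\lambda}{\lambda+r}-\mathbf{E}_0(\mathrm{e}^{-rA_T})\right)\mathbf{E}_x(\mathrm{e}^{-(\lambda+r)H_0}),$$ and $$\mathbf{E}_0(\mathrm{e}^{-rA_T})=\frac{1}{\lambda+r}\left(\lambda+r\,\frac{1-\lambda\int_{I^+}G_\lambda(0,y)\,m(\mathrm{d}y)}{1+r\int_{I^+}G_\lambda(0,y)\,\widehat f(y;\lambda+r)\,m(\mathrm{d}y)}\right),$$ where $\widehat f(y;\mu):=\mathbf{E}_y(\mathrm{e}^{-\mu H_0})$ for $\mu>0$.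
   Context: $X$ is a regular diffusion (a continuous strong Markov process that reaches every point of $I$ from every point of $I$ with positive probability) taking values in an interval $I\subseteq\mathbb{R}$ with $0\in I$. It is conservative: $\mathbf{P}_x(X_t\in I)=1$ for all $x\in I$, $t\ge0$, where $\mathbf{P}_x$ (expectation $\mathbf{E}_x$) is the law of $X$ started at $x$. Its speed measure is $m$ and its scale function $S$ is normalized by $S(0)=0$. $X$ has a transition density $p$ with respect to $m$: $\mathbf{P}_x(X_t\in B)=\int_B p(t;x,y)\,m(\mathrm{d}y)$ for Borel $B\subseteq I$. The Green kernel is $G_\lambda(x,y)=\int_0^\infty \mathrm{e}^{-\lambda t}p(t;x,y)\,\mathrm{d}t$ for $\lambda>0$; equivalently $G_\lambda(x,y)=w_\lambda^{-1}\psi_\lambda(x)\varphi_\lambda(y)$ for $x\le y$ and $G_\lambda(x,y)=w_\lambda^{-1}\psi_\lambda(y)\varphi_\lambda(x)$ for $x\ge y$, where $\psi_\lambda$ (increasing) and $\varphi_\lambda$ (decreasing) are the positive continuous solutions of $\frac{d}{dm}\frac{d}{dS}u=\lambda u$ satisfying the appropriate boundary conditions, and $w_\lambda$ is their Wronskian with respect to $S$. The first hitting time is $H_0:=\inf\{t\ge0:X_t=0\}$, with $\mathrm{e}^{-\mu H_0}:=0$ on $\{H_0=\infty\}$. $\mathrm{Leb}$ is Lebesgue measure. *)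

theory Defs
  imports "HOL-Probability.Probability"
begin

text \<open>
  The measurable space \<open>\<Omega>\<close> carries one law \<open>P x\<close> for each starting point \<open>x\<close> in the interval \<open>I\<close>.
  Process time is real (only \<open>t \<ge> 0\<close> matters); random times and filtrations are indexed by
  \<^typ>\<open>ennreal\<close>, so that they may take the value \<open>\<infinity>\<close>.
\<close>

abbreviation path_space :: "(real \<Rightarrow> real) measure" where
  "path_space \<equiv> \<Pi>\<^sub>M t\<in>{0..}. borel"

definition traj :: "(real \<Rightarrow> 'w \<Rightarrow> real) \<Rightarrow> 'w \<Rightarrow> real \<Rightarrow> real" where
  "traj X \<omega> = (\<lambda>t\<in>{0..}. X t \<omega>)"

definition traj_from :: "(real \<Rightarrow> 'w \<Rightarrow> real) \<Rightarrow> ('w \<Rightarrow> ennreal) \<Rightarrow> 'w \<Rightarrow> real \<Rightarrow> real" where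
  "traj_from X \<tau> \<omega> = (\<lambda>u\<in>{0..}. X (enn2real (\<tau> \<omega>) + u) \<omega>)"

text \<open>First hitting time of a point; it is \<open>\<infinity>\<close> if the point is never reached.\<close>

definition hitting_time :: "(real \<Rightarrow> 'w \<Rightarrow> real) \<Rightarrow> real \<Rightarrow> 'w \<Rightarrow> ennreal" where
  "hitting_time X y \<omega> = Inf {ennreal t | t. 0 \<le> t \<and> X t \<omega> = y}"

text \<open>
  A regular diffusion on \<open>I\<close>, strong Markov with respect to a filtration \<open>F\<close> to which it is adapted.
  There is no cemetery state: every path stays in \<open>I\<close> for all times, so the process is conservative.
  The strong Markov property is
  \<open>P\<^sub>x(A \<inter> {\<tau> < \<infinity>, X\<^bsub>\<tau>+\<cdot>\<^esub> \<in> B}) = E\<^sub>x[P\<^bsub>X\<^sub>\<tau>\<^esub>(X \<in> B); A \<inter> {\<tau> < \<infinity>}]\<close> for \<open>A \<in> F\<^sub>\<tau>\<close> and measurable sets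
  \<open>B\<close> of paths.
\<close>

locale conservative_regular_diffusion =
  filtration "space \<Omega>" F
  for \<Omega> :: "'w measure" and F :: "ennreal \<Rightarrow> 'w measure" +
  fixes I :: "real set" and P :: "real \<Rightarrow> 'w measure" and X :: "real \<Rightarrow> 'w \<Rightarrow> real"
  assumes interval: "is_interval I"
    and sets_F: "sets (F t) \<subseteq> sets \<Omega>"
    and prob_space_P: "x \<in> I \<Longrightarrow> prob_space (P x)"
    and sets_P: "x \<in> I \<Longrightarrow> sets (P x) = sets \<Omega>"
    and adapted: "0 \<le> t \<Longrightarrow> X t \<in> borel_measurable (F (ennreal t))"
    and state_space: "\<omega> \<in> space \<Omega> \<Longrightarrow> 0 \<le> t \<Longrightarrow> X t \<omega> \<in> I"
    and continuous_paths: "\<omega> \<in> space \<Omega> \<Longrightarrow> continuous_on {0..} (\<lambda>t. X t \<omega>)"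
    and start: "x \<in> I \<Longrightarrow> AE \<omega> in P x. X 0 \<omega> = x"
    and kernel: "B \<in> sets path_space \<Longrightarrow>
      (\<lambda>x. emeasure (P x) {\<omega> \<in> space \<Omega>. traj X \<omega> \<in> B}) \<in> borel_measurable (restrict_space borel I)"
    and strong_Markov:
      "x \<in> I \<Longrightarrow> stopping_time F \<tau> \<Longrightarrow> A \<in> sets (pre_sigma \<tau>) \<Longrightarrow> B \<in> sets path_space \<Longrightarrow>
        emeasure (P x) {\<omega> \<in> A. \<tau> \<omega> < \<infinity> \<and> traj_from X \<tau> \<omega> \<in> B} =
        (\<integral>\<^sup>+\<omega>\<in>{\<omega> \<in> A. \<tau> \<omega> < \<infinity>}.
           emeasure (P (X (enn2real (\<tau> \<omega>)) \<omega>)) {\<omega>' \<in> space \<Omega>. traj X \<omega>' \<in> B} \<partial>P x)"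
    and regular: "x \<in> I \<Longrightarrow> y \<in> I \<Longrightarrow>
      emeasure (P x) {\<omega> \<in> space \<Omega>. hitting_time X y \<omega> < \<infinity>} > 0"

definition scale_function ::
  "real set \<Rightarrow> (real \<Rightarrow> 'w measure) \<Rightarrow> (real \<Rightarrow> 'w \<Rightarrow> real) \<Rightarrow> (real \<Rightarrow> real) \<Rightarrow> bool" where
  "scale_function I P X S \<longleftrightarrow>
     continuous_on I S \<and> strict_mono_on I S \<and>
     (\<forall>a\<in>I. \<forall>b\<in>I. \<forall>x\<in>{a..b}. a < b \<longrightarrow>
        measure (P x) {\<omega> \<in> space (P x). hitting_time X a \<omega> < hitting_time X b \<omega>} =
        (S b - S x) / (S b - S a))"

text \<open>
  The speed measure belonging to the scale function \<open>S\<close>, normalised so that the generator is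
  \<open>d/dm d/dS\<close> (for Brownian motion and \<open>S x = x\<close> this gives \<open>m(dx) = 2 dx\<close>). On the interior of
  \<open>I\<close> it is determined by the expected exit times from \<open>(a, b)\<close>; an endpoint belonging to \<open>I\<close> may
  carry an atom, which is determined by the last two clauses (the Green function of the process
  started in \<open>I\<close> and killed on leaving a one-sided neighbourhood of that endpoint).
\<close>

definition speed_measure ::
  "real set \<Rightarrow> (real \<Rightarrow> 'w measure) \<Rightarrow> (real \<Rightarrow> 'w \<Rightarrow> real) \<Rightarrow> (real \<Rightarrow> real) \<Rightarrow> real measure \<Rightarrow> bool"
where
  "speed_measure I P X S m \<longleftrightarrow>
     sets m = sets (restrict_space borel I) \<and>
     (\<forall>a\<in>I. \<forall>b\<in>I. emeasure m {a..b} < \<infinity>) \<and>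
     (\<forall>a\<in>I. \<forall>b\<in>I. a < b \<longrightarrow> 0 < emeasure m {a<..<b}) \<and>
     (\<forall>a\<in>I. \<forall>b\<in>I. \<forall>x\<in>{a..b}. a < b \<longrightarrow>
        (\<integral>\<^sup>+\<omega>. min (hitting_time X a \<omega>) (hitting_time X b \<omega>) \<partial>P x) =
        (\<integral>\<^sup>+y\<in>{a<..<b}.
           ennreal ((S (min x y) - S a) * (S b - S (max x y)) / (S b - S a)) \<partial>m)) \<and>
     (\<forall>l\<in>I. \<forall>b\<in>I. \<forall>x\<in>{l..b}. (\<forall>z\<in>I. l \<le> z) \<longrightarrow>
        (\<integral>\<^sup>+\<omega>. hitting_time X b \<omega> \<partial>P x) =
        (\<integral>\<^sup>+y\<in>{l..<b}. ennreal (S b - S (max x y)) \<partial>m)) \<and>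
     (\<forall>a\<in>I. \<forall>u\<in>I. \<forall>x\<in>{a..u}. (\<forall>z\<in>I. z \<le> u) \<longrightarrow>
        (\<integral>\<^sup>+\<omega>. hitting_time X a \<omega> \<partial>P x) =
        (\<integral>\<^sup>+y\<in>{a<..u}. ennreal (S (min x y) - S a) \<partial>m))"

text \<open>
  At \<open>t = 0\<close> the law of \<open>X t\<close> is a point mass, so the density is only required for \<open>t > 0\<close>.
\<close>

definition transition_density ::
  "real set \<Rightarrow> (real \<Rightarrow> 'w measure) \<Rightarrow> (real \<Rightarrow> 'w \<Rightarrow> real) \<Rightarrow> real measure
    \<Rightarrow> (real \<Rightarrow> real \<Rightarrow> real \<Rightarrow> real) \<Rightarrow> bool" where
  "transition_density I P X m p \<longleftrightarrow>
     (\<lambda>(t, x, y). p t x y) \<in> borel_measurable (restrict_space borel ({0<..} \<times> I \<times> I)) \<and>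
     (\<forall>t>0. \<forall>x\<in>I. \<forall>y\<in>I. 0 \<le> p t x y) \<and>
     (\<forall>t>0. \<forall>x\<in>I. \<forall>B\<in>sets (restrict_space borel I).
        emeasure (P x) {\<omega> \<in> space (P x). X t \<omega> \<in> B} = (\<integral>\<^sup>+y\<in>B. ennreal (p t x y) \<partial>m))"

definition Green :: "(real \<Rightarrow> real \<Rightarrow> real \<Rightarrow> real) \<Rightarrow> real \<Rightarrow> real \<Rightarrow> real \<Rightarrow> real" where
  "Green p lam x y = (LBINT t:{0<..}. exp (- lam * t) * p t x y)"

definition exp_neg :: "real \<Rightarrow> ennreal \<Rightarrow> real" where
  "exp_neg \<mu> h = (if h = \<infinity> then 0 else exp (- \<mu> * enn2real h))"

definition hitting_laplace ::
  "(real \<Rightarrow> 'w measure) \<Rightarrow> (real \<Rightarrow> 'w \<Rightarrow> real) \<Rightarrow> real \<Rightarrow> real \<Rightarrow> real" where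
  "hitting_laplace P X y \<mu> = (\<integral>\<omega>. exp_neg \<mu> (hitting_time X 0 \<omega>) \<partial>P y)"

definition occupation_time :: "(real \<Rightarrow> 'w \<Rightarrow> real) \<Rightarrow> real \<Rightarrow> 'w \<Rightarrow> real" where
  "occupation_time X t \<omega> = measure lborel {s \<in> {0..t}. 0 \<le> X s \<omega>}"

end

theory Submission
  imports Defs
begin

text \<open>
  Write \<open>A\<^sub>t\<close> for the occupation time of \<open>[0, \<infinity>)\<close>, \<open>c = \<lambda> / (\<lambda> + r)\<close>, \<open>f y\<close> for
  \<open>E\<^sub>y exp (- (\<lambda> + r) H\<^sub>0)\<close> and \<open>u x = E\<^sub>x exp (- r A\<^sub>T)\<close>. Integrating out the independent exponential
  time gives \<open>u x = E\<^sub>x \<integral>\<^sub>0\<^sup>\<infinity> \<lambda> exp (- \<lambda> t - r A\<^sub>t) dt\<close> (lemma \<open>expectation_exp_time\<close>), so \<open>u x\<close> is the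
  expectation of a functional of the path alone. Two decompositions of that functional determine \<open>u\<close>.

  Started at \<open>x > 0\<close>, the path is nonnegative up to \<open>H\<^sub>0\<close>, so \<open>A\<^sub>t = t\<close> for \<open>t \<le> H\<^sub>0\<close>. Cutting the time
  integral at \<open>H\<^sub>0\<close> and using the strong Markov property there gives
  \<open>u x = c (1 - f x) + f x u 0\<close>, which is the first claim (lemma \<open>first_passage_decomposition\<close>).

  For the second claim, \<open>1 - exp (- r A\<^sub>t)\<close> is the integral of
  \<open>r exp (- r (A\<^sub>t - A\<^sub>s))\<close> over the times \<open>s \<le> t\<close> with \<open>X\<^sub>s \<ge> 0\<close>. Taking Laplace transforms and applying
  the Markov property at each \<open>s\<close> gives the perturbation equation of the resolvent,
  \<open>1 = u x + r \<integral>\<^sub>0\<^sup>\<infinity> exp (- \<lambda> s) E\<^sub>x [u X\<^sub>s; X\<^sub>s \<ge> 0] ds\<close> (lemma \<open>occ_laplace_resolvent_equation\<close>). By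
  Fubini the integral equals \<open>\<integral> G(x, y) u y m(dy)\<close> over \<open>I \<inter> [0, \<infinity>)\<close> (lemma
  \<open>Green_kernel_resolvent\<close>). At \<open>x = 0\<close>, inserting \<open>u y = c - (c - u 0) f y\<close> from the first claim leaves
  a linear equation for \<open>u 0\<close>, and solving it is the second claim (lemma \<open>occ_laplace_zero\<close>).
\<close>

section \<open>The occupation clock of a set of times\<close>

definition clock :: "real set \<Rightarrow> real \<Rightarrow> real" where
  "clock D t = measure lborel ({0..t} \<inter> D)"

definition shift_set :: "real \<Rightarrow> real set \<Rightarrow> real set" where
  "shift_set s D = {u. 0 \<le> u \<and> s + u \<in> D}"

text \<open>
  This is \<open>E exp (- r (clock D T))\<close> for a time \<open>T\<close> that is exponentially distributed with rate \<open>lam\<close>.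
\<close>

definition exp_clock_laplace :: "real \<Rightarrow> real \<Rightarrow> real set \<Rightarrow> ennreal" where
  "exp_clock_laplace lam r D =
     (\<integral>\<^sup>+t. ennreal (lam * exp (- lam * t - r * clock D t)) * indicator {0..} t \<partial>lborel)"

lemma fmeasurable_Icc_Int:
  assumes "D \<in> sets borel"
  shows "{a..b::real} \<inter> D \<in> fmeasurable lborel"
proof (rule fmeasurableI)
  show "emeasure lborel ({a..b} \<inter> D) < \<infinity>"
    by (rule le_less_trans[OF emeasure_mono[of _ "{a..b}"]]) (auto simp: emeasure_lborel_Icc_eq)
qed (use assms in auto)

lemma clock_nonneg [simp]: "0 \<le> clock D t"
  by (simp add: clock_def)

lemma clock_0 [simp]: "clock D 0 = 0"
proof -
  have "emeasure lborel ({0::real} \<inter> D) \<le> emeasure lborel {0::real}"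
    by (intro emeasure_mono) auto
  then have "emeasure lborel ({0::real} \<inter> D) = 0" by simp
  then show ?thesis unfolding clock_def
    by (intro measure_eq_emeasure_eq_ennreal) simp_all
qed

lemma clock_mono:
  assumes "D \<in> sets borel" "s \<le> t"
  shows "clock D s \<le> clock D t"
  unfolding clock_def using assms
  by (intro measure_mono_fmeasurable fmeasurable_Icc_Int) auto

lemma clock_diff:
  assumes D: "D \<in> sets borel" and st: "0 \<le> s" "s \<le> t"
  shows "clock D t - clock D s = measure lborel ({s<..t} \<inter> D)"
proof -
  have "measure lborel ({0..t} \<inter> D - {0..s} \<inter> D) = clock D t - clock D s"
    unfolding clock_def using D st
    by (intro measurable_measure_Diff fmeasurable_Icc_Int) auto
  moreover have "{0..t} \<inter> D - {0..s} \<inter> D = {s<..t} \<inter> D"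
    using st by auto
  ultimately show ?thesis by simp
qed

lemma clock_lipschitz:
  assumes D: "D \<in> sets borel" and st: "0 \<le> s" "s \<le> t"
  shows "clock D t - clock D s \<le> t - s"
proof -
  have "measure lborel ({s<..t} \<inter> D) \<le> measure lborel {s<..t}"
    using D st by (intro measure_mono_fmeasurable) (auto intro!: fmeasurableI)
  then show ?thesis using clock_diff[OF assms] st by simp
qed

lemma continuous_on_clock:
  assumes D: "D \<in> sets borel"
  shows "continuous_on {0..} (clock D)"
proof (rule lipschitz_on_continuous_on[where L = 1], rule lipschitz_onI)
  show "dist (clock D x) (clock D y) \<le> 1 * dist x y" if "x \<in> {0..}" "y \<in> {0..}" for x y
    using clock_lipschitz[OF D, of x y] clock_lipschitz[OF D, of y x]
      clock_mono[OF D, of x y] clock_mono[OF D, of y x] that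
    by (auto simp: dist_real_def abs_if)
qed simp

lemma borel_measurable_clock [measurable]:
  assumes D: "D \<in> sets borel"
  shows "clock D \<in> borel_measurable borel"
  by (rule borel_measurable_mono) (auto simp: mono_def clock_mono[OF D])

lemma borel_measurable_shift_set [measurable]:
  assumes "D \<in> sets borel"
  shows "shift_set s D \<in> sets borel"
proof -
  have [measurable]: "Measurable.pred borel (\<lambda>x. x \<in> D)"
    using assms by (simp add: pred_def)
  have "{u \<in> space borel. 0 \<le> u \<and> s + u \<in> D} \<in> sets borel"
    by measurable
  then show ?thesis by (simp add: shift_set_def)
qed

lemma clock_shift_set:
  assumes D: "D \<in> sets borel" and s: "0 \<le> s" and u: "0 \<le> u"
  shows "clock (shift_set s D) u = clock D (s + u) - clock D s"
proof -
  have "measure lborel ({s..s + u} \<inter> D) = measure (distr lborel borel ((+) s)) ({s..s + u} \<inter> D)"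
    by (simp add: lborel_distr_plus)
  also have "\<dots> = measure lborel ((+) s -` ({s..s + u} \<inter> D))"
    using D by (subst measure_distr) auto
  also have "(+) s -` ({s..s + u} \<inter> D) = {0..u} \<inter> shift_set s D"
    by (auto simp: shift_set_def)
  finally have "clock (shift_set s D) u = measure lborel ({s..s + u} \<inter> D)"
    by (simp add: clock_def)
  also have "\<dots> = measure lborel ({s<..s + u} \<inter> D)"
  proof -
    have "emeasure lborel ({s..s + u} \<inter> D) = emeasure lborel ({s<..s + u} \<inter> D)"
    proof (rule emeasure_eq_AE)
      show "AE x in lborel. (x \<in> {s..s + u} \<inter> D) = (x \<in> {s<..s + u} \<inter> D)"
        using AE_lborel_singleton[of s] by eventually_elim auto
    qed (use D in auto)
    then show ?thesis unfolding measure_def by (rule arg_cong)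
  qed
  finally show ?thesis using clock_diff[OF D s, of "s + u"] u by simp
qed

text \<open>
  The clock runs at unit speed on \<open>D\<close> and stands still off \<open>D\<close>, so it carries Lebesgue measure on
  \<open>D\<close> to Lebesgue measure on its range. This replaces a substitution rule, which is awkward because
  the clock need not be differentiable. Both measures are compared on half-lines: up to time \<open>t\<close>, the
  clock exceeds a level \<open>x\<close> of its range exactly after the last time at which it equals \<open>x\<close>.
\<close>

lemma distr_clock:
  assumes D: "D \<in> sets borel" and t: "0 \<le> t"
  shows "distr (density lborel (indicator ({0..t} \<inter> D))) borel (clock D) =
         density lborel (indicator {0..clock D t})" (is "?M = ?N")
proof (rule measure_eqI_lessThan)
  have m[measurable]: "clock D \<in> borel_measurable borel" using D by measurable
  have [measurable]: "{0..t} \<inter> D \<in> sets borel" using D by simp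
  have M: "emeasure ?M {x<..} = emeasure lborel ({0..t} \<inter> D \<inter> {s. x < clock D s})" for x
  proof -
    have "{s \<in> space borel. x < clock D s} \<in> sets borel" by measurable
    then have 1: "{s. x < clock D s} \<in> sets borel" by simp
    have "emeasure ?M {x<..} = emeasure (density lborel (indicator ({0..t} \<inter> D))) {s. x < clock D s}"
      by (subst emeasure_distr) (auto simp: vimage_def)
    also have "\<dots> = emeasure lborel ({0..t} \<inter> D \<inter> {s. x < clock D s})"
      using 1 D by (subst emeasure_density) (auto simp flip: indicator_inter_arith)
    finally show ?thesis .
  qed
  have N: "emeasure ?N {x<..} = emeasure lborel ({0..clock D t} \<inter> {x<..})" for x
    by (subst emeasure_density) (auto simp flip: indicator_inter_arith)
  have fin: "emeasure lborel ({0..t} \<inter> D) = clock D t"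
    using fmeasurable_Icc_Int[OF D, of 0 t] by (simp add: clock_def emeasure_eq_measure2)
  show "emeasure ?M {x<..} < \<infinity>" for x
  proof -
    have "emeasure ?M {x<..} \<le> emeasure lborel ({0..t} \<inter> D)"
      unfolding M using D by (intro emeasure_mono) auto
    then show ?thesis using fin by (auto intro: le_less_trans)
  qed
  show "emeasure ?M {x<..} = emeasure ?N {x<..}" for x
  proof -
    consider "x < 0" | "clock D t \<le> x" | "0 \<le> x" "x < clock D t" by linarith
    then show ?thesis
    proof cases
      case 1
      then have "x < clock D s" for s using clock_nonneg[of D s] by linarith
      then have "{0..t} \<inter> D \<inter> {s. x < clock D s} = {0..t} \<inter> D" by auto
      moreover have "{0..clock D t} \<inter> {x<..} = {0..clock D t}" using 1 by auto
      ultimately show ?thesis unfolding M N using fin by simp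
    next
      case 2
      then have "{0..t} \<inter> D \<inter> {s. x < clock D s} = {}"
        using clock_mono[OF D, of _ t] by force
      moreover have "{0..clock D t} \<inter> {x<..} = {}" using 2 by auto
      ultimately show ?thesis unfolding M N by simp
    next
      case 3
      let ?C = "{s \<in> {0..t}. clock D s \<le> x}"
      define c where "c = Sup ?C"
      have cont: "continuous_on {0..t} (clock D)"
        using continuous_on_clock[OF D] by (rule continuous_on_subset) auto
      have C: "closed ?C"
        using cont by (intro continuous_closed_preimage_constant continuous_on_closed_Collect_le) auto
      have bdd: "bdd_above ?C" by (rule bdd_aboveI[of _ t]) auto
      obtain b where b: "0 \<le> b" "b \<le> t" "clock D b = x"
        using IVT'[of "clock D" 0 x t] 3 t cont by auto
      then have "b \<in> ?C" by auto
      then have cC: "c \<in> ?C"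
        unfolding c_def using C bdd by (intro closed_contains_Sup) auto
      have "b \<le> c" unfolding c_def using \<open>b \<in> ?C\<close> bdd by (rule cSup_upper)
      then have cx: "clock D c = x" using clock_mono[OF D, of b c] cC b by auto
      have "{0..t} \<inter> D \<inter> {s. x < clock D s} = {c<..t} \<inter> D"
      proof (intro equalityI subsetI)
        fix s assume s: "s \<in> {0..t} \<inter> D \<inter> {s. x < clock D s}"
        then have "c < s" using clock_mono[OF D, of s c] cx by (cases "c < s") auto
        then show "s \<in> {c<..t} \<inter> D" using s by auto
      next
        fix s assume s: "s \<in> {c<..t} \<inter> D"
        have "s \<notin> ?C" using cSup_upper[OF _ bdd, of s] s unfolding c_def[symmetric] by auto
        then show "s \<in> {0..t} \<inter> D \<inter> {s. x < clock D s}" using s cC by auto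
      qed
      moreover have "emeasure lborel ({c<..t} \<inter> D) = ennreal (clock D t - x)"
      proof -
        have "{c<..t} \<inter> D \<in> fmeasurable lborel"
          by (rule fmeasurableI2[OF fmeasurable_Icc_Int[OF D, of c t]]) (use D in auto)
        then show ?thesis
          using clock_diff[OF D, of c t] cC cx by (simp add: emeasure_eq_measure2)
      qed
      moreover have "{0..clock D t} \<inter> {x<..} = {x<..clock D t}" using 3 by auto
      ultimately show ?thesis unfolding M N using 3 by simp
    qed
  qed
qed (simp_all)

text \<open>
  The fundamental theorem of calculus for \<open>exp (- r (clock D t - a))\<close> in the variable \<open>a\<close>, carried
  over to the time variable by \<open>distr_clock\<close>.
\<close>

lemma exp_clock_FTC:
  assumes D: "D \<in> sets borel" and t: "0 \<le> t" and r: "0 \<le> r"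
  shows "ennreal (exp (- r * clock D t)) +
    (\<integral>\<^sup>+s. ennreal (r * exp (- r * (clock D t - clock D s))) * indicator ({0..t} \<inter> D) s \<partial>lborel) = 1"
proof -
  let ?c = "clock D t"
  have m[measurable]: "clock D \<in> borel_measurable borel" using D by measurable
  have [measurable]: "{0..t} \<inter> D \<in> sets borel" using D by simp
  have "(\<integral>\<^sup>+s. ennreal (r * exp (- r * (?c - clock D s))) * indicator ({0..t} \<inter> D) s \<partial>lborel)
     = (\<integral>\<^sup>+a. ennreal (r * exp (- r * (?c - a)))
          \<partial>distr (density lborel (indicator ({0..t} \<inter> D))) borel (clock D))"
    by (simp add: nn_integral_distr nn_integral_density mult.commute)
  also have "\<dots> = (\<integral>\<^sup>+a. ennreal (r * exp (- r * (?c - a))) * indicator {0..?c} a \<partial>lborel)"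
    unfolding distr_clock[OF D t] by (simp add: nn_integral_density mult.commute)
  also have "\<dots> = ennreal (exp (- r * (?c - ?c)) - exp (- r * (?c - 0)))"
    by (rule nn_integral_FTC_Icc) (use r in \<open>auto intro!: derivative_eq_intros\<close>)
  finally show ?thesis
    using r by (simp flip: ennreal_plus)
qed

lemma nn_integral_exp_tail:
  assumes "0 < lam"
  shows "(\<integral>\<^sup>+t. ennreal (lam * exp (- lam * t)) * indicator {a..} t \<partial>lborel) = ennreal (exp (- lam * a))"
proof -
  have "((\<lambda>t. - exp (- lam * t)) \<longlongrightarrow> - 0) at_top"
    using assms by (intro tendsto_minus filterlim_compose[OF exp_at_bot]
        filterlim_tendsto_neg_mult_at_bot[OF tendsto_const]) (auto simp: filterlim_ident)
  then have "(\<integral>\<^sup>+t. ennreal (lam * exp (- lam * t)) * indicator {a..} t \<partial>lborel)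
      = ennreal (- 0 - (- exp (- lam * a)))"
    using assms by (intro nn_integral_FTC_atLeast) (auto intro!: derivative_eq_intros)
  then show ?thesis by simp
qed

lemma nn_integral_exp_density:
  assumes "0 < lam"
  shows "(\<integral>\<^sup>+t. ennreal (lam * exp (- lam * t)) * indicator {0..} t \<partial>lborel) = 1"
  using nn_integral_exp_tail[OF assms, of 0] by simp

lemma exp_clock_laplace_le_1:
  assumes "0 < lam" "0 \<le> r"
  shows "exp_clock_laplace lam r D \<le> 1"
proof -
  have "exp_clock_laplace lam r D \<le>
      (\<integral>\<^sup>+t. ennreal (lam * exp (- lam * t)) * indicator {0..} t \<partial>lborel)"
    unfolding exp_clock_laplace_def using assms
    by (intro nn_integral_mono mult_right_mono ennreal_leI mult_left_mono) auto
  then show ?thesis using nn_integral_exp_density[OF assms(1)] by simp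
qed

lemma exp_clock_laplace_shift:
  assumes D: "D \<in> sets borel" and h: "0 \<le> h" and lam: "0 < lam"
  shows "(\<integral>\<^sup>+t. ennreal (lam * exp (- lam * t - r * clock D t)) * indicator {h..} t \<partial>lborel) =
    ennreal (exp (- lam * h - r * clock D h)) * exp_clock_laplace lam r (shift_set h D)"
proof -
  have m[measurable]: "clock D \<in> borel_measurable borel" using D by measurable
  have [measurable]: "shift_set h D \<in> sets borel" using D by measurable
  have [measurable]: "clock (shift_set h D) \<in> borel_measurable borel" by measurable
  have "(\<integral>\<^sup>+t. ennreal (lam * exp (- lam * t - r * clock D t)) * indicator {h..} t \<partial>lborel)
     = (\<integral>\<^sup>+u. ennreal (lam * exp (- lam * (h + u) - r * clock D (h + u))) * indicator {h..} (h + u) \<partial>lborel)"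
    by (subst nn_integral_real_affine[where c = 1 and t = h]) (auto simp del: mult_minus_left)
  also have "\<dots> = (\<integral>\<^sup>+u. ennreal (exp (- lam * h - r * clock D h)) *
      (ennreal (lam * exp (- lam * u - r * clock (shift_set h D) u)) * indicator {0..} u) \<partial>lborel)"
  proof (rule nn_integral_cong)
    fix u :: real
    show "ennreal (lam * exp (- lam * (h + u) - r * clock D (h + u))) * indicator {h..} (h + u) =
      ennreal (exp (- lam * h - r * clock D h)) *
      (ennreal (lam * exp (- lam * u - r * clock (shift_set h D) u)) * indicator {0..} u)"
    proof (cases "0 \<le> u")
      case True
      have "- lam * (h + u) - r * clock D (h + u) =
          (- lam * h - r * clock D h) + (- lam * u - r * clock (shift_set h D) u)"
        unfolding clock_shift_set[OF D h True] by (simp add: algebra_simps)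
      then have "lam * exp (- lam * (h + u) - r * clock D (h + u)) =
        exp (- lam * h - r * clock D h) * (lam * exp (- lam * u - r * clock (shift_set h D) u))"
        by (simp only: exp_add mult_ac)
      then show ?thesis using True lam by (simp add: ennreal_mult mult.left_commute)
    qed auto
  qed
  also have "\<dots> = ennreal (exp (- lam * h - r * clock D h)) * exp_clock_laplace lam r (shift_set h D)"
    unfolding exp_clock_laplace_def by (rule nn_integral_cmult) measurable
  finally show ?thesis .
qed

lemma exp_clock_laplace_split:
  assumes D: "D \<in> sets borel" and h: "0 \<le> h" and lam: "0 < lam"
  shows "exp_clock_laplace lam r D =
    (\<integral>\<^sup>+t. ennreal (lam * exp (- lam * t - r * clock D t)) * indicator {0..<h} t \<partial>lborel) +
    ennreal (exp (- lam * h - r * clock D h)) * exp_clock_laplace lam r (shift_set h D)"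
proof -
  have m[measurable]: "clock D \<in> borel_measurable borel" using D by measurable
  have "exp_clock_laplace lam r D =
     (\<integral>\<^sup>+t. ennreal (lam * exp (- lam * t - r * clock D t)) * indicator {0..<h} t +
        ennreal (lam * exp (- lam * t - r * clock D t)) * indicator {h..} t \<partial>lborel)"
    unfolding exp_clock_laplace_def using h by (intro nn_integral_cong) (auto simp: indicator_def)
  also have "\<dots> = (\<integral>\<^sup>+t. ennreal (lam * exp (- lam * t - r * clock D t)) * indicator {0..<h} t \<partial>lborel) +
     (\<integral>\<^sup>+t. ennreal (lam * exp (- lam * t - r * clock D t)) * indicator {h..} t \<partial>lborel)"
    by (rule nn_integral_add) measurable
  finally show ?thesis
    unfolding exp_clock_laplace_shift[OF assms] .
qed

text \<open>
  Pathwise form of the resolvent equation: integrate \<open>exp_clock_FTC\<close> against the exponential density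
  in \<open>t\<close> and exchange the integrals. For a fixed \<open>s\<close>, the integral over \<open>t \<ge> s\<close> sees the clock only
  through its increments after \<open>s\<close>, which form the clock of the shifted set.
\<close>

lemma exp_clock_laplace_perturbation:
  assumes D: "D \<in> sets borel" and lam: "0 < lam" and r: "0 \<le> r"
  shows "exp_clock_laplace lam r D +
    ennreal r * (\<integral>\<^sup>+s. ennreal (exp (- lam * s)) *
       (indicator (D \<inter> {0..}) s * exp_clock_laplace lam r (shift_set s D)) \<partial>lborel) = 1"
proof -
  have m[measurable]: "clock D \<in> borel_measurable borel" using D by measurable
  have [measurable]: "Measurable.pred borel (\<lambda>x. x \<in> D)" using D by (simp add: pred_def)
  have [measurable]: "(\<lambda>s. indicator D s :: ennreal) \<in> borel_measurable borel" using D by simp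
  \<comment> \<open>The double integrand on \<open>0 \<le> s \<le> t\<close>, \<open>s \<in> D\<close>, with the weight of \<open>t\<close> kept apart from the \<open>s\<close>-integrand of \<open>exp_clock_FTC\<close>.\<close>
  define k where "k t s = ennreal (lam * exp (- lam * t)) * indicator {0..} t *
      (ennreal (r * exp (- r * (clock D t - clock D s))) * (indicator {0..} s * indicator {s..} t * indicator D s))"
    for t s
  have ksplit: "ennreal (lam * exp (- lam * t)) * indicator {0..} t =
      ennreal (lam * exp (- lam * t - r * clock D t)) * indicator {0..} t + (\<integral>\<^sup>+s. k t s \<partial>lborel)" for t
  proof (cases "0 \<le> t")
    case True
    have "ennreal (lam * exp (- lam * t)) = ennreal (lam * exp (- lam * t)) *
       (ennreal (exp (- r * clock D t)) +
       (\<integral>\<^sup>+s. ennreal (r * exp (- r * (clock D t - clock D s))) * indicator ({0..t} \<inter> D) s \<partial>lborel))"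
      unfolding exp_clock_FTC[OF D True r] by simp
    also have "\<dots> = ennreal (lam * exp (- lam * t - r * clock D t)) + (\<integral>\<^sup>+s. k t s \<partial>lborel)"
    proof -
      have 1: "ennreal (lam * exp (- lam * t)) * ennreal (exp (- r * clock D t)) =
          ennreal (lam * exp (- lam * t - r * clock D t))"
        using lam by (simp add: exp_diff exp_minus divide_inverse ennreal_mult[symmetric] mult.assoc)
      have "ennreal (lam * exp (- lam * t)) *
        (\<integral>\<^sup>+s. ennreal (r * exp (- r * (clock D t - clock D s))) * indicator ({0..t} \<inter> D) s \<partial>lborel)
        = (\<integral>\<^sup>+s. ennreal (lam * exp (- lam * t)) *
            (ennreal (r * exp (- r * (clock D t - clock D s))) * indicator ({0..t} \<inter> D) s) \<partial>lborel)"
        by (rule nn_integral_cmult[symmetric]) (use D in measurable)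
      also have "\<dots> = (\<integral>\<^sup>+s. k t s \<partial>lborel)"
        unfolding k_def using True by (intro nn_integral_cong) (auto simp: indicator_def)
      finally show ?thesis using 1 by (simp add: distrib_left)
    qed
    finally show ?thesis using True by simp
  qed (simp add: k_def)
  have kint: "(\<integral>\<^sup>+t. k t s \<partial>lborel) = ennreal r * (ennreal (exp (- lam * s)) *
       (indicator (D \<inter> {0..}) s * exp_clock_laplace lam r (shift_set s D)))" for s
  proof (cases "0 \<le> s \<and> s \<in> D")
    case True
    have "(\<integral>\<^sup>+t. k t s \<partial>lborel) = (\<integral>\<^sup>+t. ennreal (r * exp (r * clock D s)) *
        (ennreal (lam * exp (- lam * t - r * clock D t)) * indicator {s..} t) \<partial>lborel)"
    proof (rule nn_integral_cong)
      fix t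
      have "lam * exp (- lam * t) * (r * exp (- r * (clock D t - clock D s))) =
         r * exp (r * clock D s) * (lam * exp (- lam * t - r * clock D t))"
        by (simp add: algebra_simps exp_diff exp_minus exp_add divide_inverse)
      then show "k t s = ennreal (r * exp (r * clock D s)) *
        (ennreal (lam * exp (- lam * t - r * clock D t)) * indicator {s..} t)"
        using True lam r by (auto simp: k_def indicator_def ennreal_mult[symmetric])
    qed
    also have "\<dots> = ennreal (r * exp (r * clock D s)) *
       (\<integral>\<^sup>+t. ennreal (lam * exp (- lam * t - r * clock D t)) * indicator {s..} t \<partial>lborel)"
      by (rule nn_integral_cmult) measurable
    also have "\<dots> = ennreal (r * exp (r * clock D s)) * ennreal (exp (- lam * s - r * clock D s)) *
        exp_clock_laplace lam r (shift_set s D)"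
      using True by (subst exp_clock_laplace_shift[OF D _ lam]) (auto simp: mult.assoc)
    also have "ennreal (r * exp (r * clock D s)) * ennreal (exp (- lam * s - r * clock D s)) =
        ennreal r * ennreal (exp (- lam * s))"
      using r by (simp add: ennreal_mult[symmetric] exp_diff)
    finally show ?thesis using True by (simp add: mult.assoc)
  qed (auto simp: k_def indicator_def)
  have km[measurable]: "case_prod k \<in> borel_measurable (lborel \<Otimes>\<^sub>M lborel)"
  proof -
    have "(\<lambda>x::real \<times> real. indicator {snd x..} (fst x) :: ennreal) =
        (\<lambda>x. if snd x \<le> fst x then 1 else 0)" by (auto simp: indicator_def)
    then have [measurable]: "(\<lambda>x::real \<times> real. indicator {snd x..} (fst x) :: ennreal) \<in>
      borel_measurable (lborel \<Otimes>\<^sub>M lborel)" by simp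
    show ?thesis unfolding k_def case_prod_beta' by measurable
  qed
  have "1 = (\<integral>\<^sup>+t. ennreal (lam * exp (- lam * t)) * indicator {0..} t \<partial>lborel)"
    using nn_integral_exp_density[OF lam] by simp
  also have "\<dots> = (\<integral>\<^sup>+t. ennreal (lam * exp (- lam * t - r * clock D t)) * indicator {0..} t +
       (\<integral>\<^sup>+s. k t s \<partial>lborel) \<partial>lborel)"
    by (subst ksplit) (rule refl)
  also have "\<dots> = exp_clock_laplace lam r D + (\<integral>\<^sup>+t. (\<integral>\<^sup>+s. k t s \<partial>lborel) \<partial>lborel)"
    unfolding exp_clock_laplace_def by (rule nn_integral_add) measurable
  also have "(\<integral>\<^sup>+t. (\<integral>\<^sup>+s. k t s \<partial>lborel) \<partial>lborel) = (\<integral>\<^sup>+s. (\<integral>\<^sup>+t. k t s \<partial>lborel) \<partial>lborel)"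
    by (rule lborel_pair.Fubini'[OF km, symmetric])
  also have "\<dots> = (\<integral>\<^sup>+s. ennreal r * (ennreal (exp (- lam * s)) *
       (indicator (D \<inter> {0..}) s * exp_clock_laplace lam r (shift_set s D))) \<partial>lborel)"
    unfolding kint ..
  also have "\<dots> = ennreal r * (\<integral>\<^sup>+s. ennreal (exp (- lam * s)) *
       (indicator (D \<inter> {0..}) s * exp_clock_laplace lam r (shift_set s D)) \<partial>lborel)"
  proof (cases "r = 0")
    case False
    then have r0: "0 < r" using r by simp
    \<comment> \<open>Measurability of the shifted transform in \<open>s\<close> is read off from Fubini after dividing by \<open>r\<close>.\<close>
    have "(\<lambda>s. \<integral>\<^sup>+t. k t s \<partial>lborel) \<in> borel_measurable lborel" by measurable
    then have "(\<lambda>s. ennreal (1 / r) * (\<integral>\<^sup>+t. k t s \<partial>lborel)) \<in> borel_measurable lborel" by measurable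
    also have "(\<lambda>s. ennreal (1 / r) * (\<integral>\<^sup>+t. k t s \<partial>lborel)) = (\<lambda>s. ennreal (exp (- lam * s)) *
       (indicator (D \<inter> {0..}) s * exp_clock_laplace lam r (shift_set s D)))"
      unfolding kint using r0 by (simp add: mult.assoc[symmetric] ennreal_mult[symmetric])
    finally show ?thesis by (rule nn_integral_cmult)
  qed simp
  finally show ?thesis by simp
qed

lemma clock_full:
  assumes "0 \<le> t" "{0..<t} \<subseteq> D" "D \<in> sets borel"
  shows "clock D t = t"
proof -
  have "emeasure lborel ({0..t} \<inter> D) = emeasure lborel {0..t}"
  proof (rule emeasure_eq_AE)
    show "AE x in lborel. (x \<in> {0..t} \<inter> D) = (x \<in> {0..t})"
      using AE_lborel_singleton[of t] by eventually_elim (use assms(2) in auto)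
  qed (use assms(3) in auto)
  then show ?thesis
    unfolding clock_def using assms(1) by (intro measure_eq_emeasure_eq_ennreal) auto
qed

text \<open>
  As long as the clock has not missed any time it shows \<open>t\<close>, so the transform up to \<open>h\<close> is that of an
  exponential time with rate \<open>lam + r\<close>.
\<close>

lemma exp_clock_laplace_full:
  assumes D: "D \<in> sets borel" and h: "0 \<le> h" "{0..<h} \<subseteq> D" and lam: "0 < lam" and r: "0 \<le> r"
  shows "exp_clock_laplace lam r D =
    ennreal (lam / (lam + r) * (1 - exp (- (lam + r) * h))) +
    ennreal (exp (- (lam + r) * h)) * exp_clock_laplace lam r (shift_set h D)"
proof -
  have lr: "0 < lam + r" using lam r by simp
  have c: "clock D t = t" if "0 \<le> t" "t \<le> h" for t
    using h that by (intro clock_full[OF _ _ D]) auto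
  have "(\<integral>\<^sup>+t. ennreal (lam * exp (- lam * t - r * clock D t)) * indicator {0..<h} t \<partial>lborel) =
      (\<integral>\<^sup>+t. ennreal (lam * exp (- (lam + r) * t)) * indicator {0..h} t \<partial>lborel)"
  proof (rule nn_integral_cong_AE)
    show "AE t in lborel. ennreal (lam * exp (- lam * t - r * clock D t)) * indicator {0..<h} t =
      ennreal (lam * exp (- (lam + r) * t)) * indicator {0..h} t"
      using AE_lborel_singleton[of h]
      by eventually_elim (auto simp: indicator_def c algebra_simps)
  qed
  also have "\<dots> = ennreal (lam / (lam + r) * (1 - exp (- (lam + r) * h)))"
  proof -
    define c \<mu> where "c = lam / (lam + r)" and "\<mu> = lam + r"
    then have lam_eq: "lam = c * \<mu>" and "0 \<le> c" "0 < \<mu>" using lam lr by simp_all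
    then have int: "(\<integral>\<^sup>+t. ennreal (c * \<mu> * exp (- \<mu> * t)) * indicator {0..h} t \<partial>lborel) =
        ennreal (- c * exp (- \<mu> * h) - (- c * exp (- \<mu> * 0)))"
      using h by (intro nn_integral_FTC_Icc) (auto intro!: derivative_eq_intros)
    have diff: "- c * exp (- \<mu> * h) - (- c * exp (- \<mu> * 0)) = c * (1 - exp (- \<mu> * h))"
      by (simp add: algebra_simps)
    show ?thesis
      using int unfolding lam_eq[symmetric] diff unfolding c_def \<mu>_def .
  qed
  finally have 1: "(\<integral>\<^sup>+t. ennreal (lam * exp (- lam * t - r * clock D t)) * indicator {0..<h} t \<partial>lborel) =
      ennreal (lam / (lam + r) * (1 - exp (- (lam + r) * h)))" .
  have 2: "- lam * h - r * clock D h = - (lam + r) * h"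
    using c[of h] h by (simp add: algebra_simps)
  show ?thesis
    unfolding exp_clock_laplace_split[OF D h(1) lam] 1 2 ..
qed

lemma exp_clock_laplace_UNIV:
  assumes D: "D \<in> sets borel" "{0..} \<subseteq> D" and lam: "0 < lam" and r: "0 \<le> r"
  shows "exp_clock_laplace lam r D = ennreal (lam / (lam + r))"
proof -
  have lr: "0 < lam + r" using lam r by simp
  have "exp_clock_laplace lam r D =
     (\<integral>\<^sup>+t. ennreal (lam / (lam + r)) * (ennreal ((lam + r) * exp (- (lam + r) * t)) * indicator {0..} t) \<partial>lborel)"
    unfolding exp_clock_laplace_def
  proof (rule nn_integral_cong)
    fix t :: real
    show "ennreal (lam * exp (- lam * t - r * clock D t)) * indicator {0..} t =
      ennreal (lam / (lam + r)) * (ennreal ((lam + r) * exp (- (lam + r) * t)) * indicator {0..} t)"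
    proof (cases "0 \<le> t")
      case True
      have "clock D t = t" using True D by (intro clock_full) auto
      then have "- lam * t - r * clock D t = - (lam + r) * t" by (simp add: algebra_simps)
      moreover have "lam * exp (- (lam + r) * t) = lam / (lam + r) * ((lam + r) * exp (- (lam + r) * t))"
        using lr by simp
      moreover have "ennreal (lam / (lam + r) * ((lam + r) * exp (- (lam + r) * t))) =
          ennreal (lam / (lam + r)) * ennreal ((lam + r) * exp (- (lam + r) * t))"
        using lam lr by (intro ennreal_mult) auto
      ultimately show ?thesis
        using True by (simp only: atLeast_iff indicator_simps mult_1_right)
    qed simp
  qed
  also have "\<dots> = ennreal (lam / (lam + r))"
    by (subst nn_integral_cmult) (auto simp: nn_integral_exp_density[OF lr, simplified])
  finally show ?thesis .
qed

section \<open>Path functionals\<close>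

text \<open>
  On the product space of all paths the evaluation \<open>(w, s) \<mapsto> w s\<close> is not jointly measurable. The limit
  along grids with mesh tending to \<open>0\<close> is, and it agrees with evaluation at continuous paths
  (lemma \<open>path_val_continuous\<close>). Path functionals defined through it are therefore measurable on the
  whole path space, as the strong Markov property requires.
\<close>

definition path_val :: "(real \<Rightarrow> real) \<Rightarrow> real \<Rightarrow> real" where
  "path_val w s = lim (\<lambda>n. w (real (nat \<lfloor>s * real (Suc n)\<rfloor>) / real (Suc n)))"

lemma borel_measurable_path_val:
  "(\<lambda>z. path_val (fst z) (snd z)) \<in> borel_measurable (path_space \<Otimes>\<^sub>M borel)"
proof -
  have "(\<lambda>z. (fst z) (real (nat \<lfloor>snd z * real (Suc n)\<rfloor>) / real (Suc n)))
      \<in> borel_measurable (path_space \<Otimes>\<^sub>M borel)" for n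
  proof (rule measurable_compose_countable[where f = "\<lambda>k z. (fst z) (real k / real (Suc n))"
        and g = "\<lambda>z. nat \<lfloor>snd z * real (Suc n)\<rfloor>"])
    show "(\<lambda>z. (fst z) (real k / real (Suc n))) \<in> borel_measurable (path_space \<Otimes>\<^sub>M borel)" for k
      by (rule measurable_compose[OF measurable_fst measurable_component_singleton]) simp
  qed measurable
  then show ?thesis
    unfolding path_val_def by (rule borel_measurable_lim_metric)
qed

lemma measurable_path_val [measurable (raw)]:
  assumes "f \<in> measurable N path_space" "g \<in> borel_measurable N"
  shows "(\<lambda>z. path_val (f z) (g z)) \<in> borel_measurable N"
  using measurable_compose[OF measurable_Pair[OF assms] borel_measurable_path_val] by simp

lemma path_val_continuous:
  assumes w: "continuous_on {0..} w" and s: "0 \<le> s"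
  shows "path_val w s = w s"
proof -
  let ?g = "\<lambda>n. real (nat \<lfloor>s * real (Suc n)\<rfloor>) / real (Suc n)"
  have fl: "real (nat \<lfloor>s * real (Suc n)\<rfloor>) = of_int \<lfloor>s * real (Suc n)\<rfloor>" for n
    using s by simp
  have "?g \<longlonglongrightarrow> s"
  proof (rule real_tendsto_sandwich)
    show "\<forall>\<^sub>F n in sequentially. s - 1 / real (Suc n) \<le> ?g n"
    proof (intro always_eventually allI)
      fix n
      have "s * real (Suc n) - 1 \<le> of_int \<lfloor>s * real (Suc n)\<rfloor>" by linarith
      then have "(s * real (Suc n) - 1) / real (Suc n) \<le> ?g n"
        unfolding fl by (intro divide_right_mono) auto
      then show "s - 1 / real (Suc n) \<le> ?g n"
        by (simp add: diff_divide_distrib)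
    qed
    show "\<forall>\<^sub>F n in sequentially. ?g n \<le> s"
      unfolding fl by (intro always_eventually allI) (simp add: divide_le_eq)
    show "(\<lambda>n. s - 1 / real (Suc n)) \<longlonglongrightarrow> s"
      using tendsto_diff[OF tendsto_const LIMSEQ_inverse_real_of_nat, of s] by (simp add: inverse_eq_divide)
  qed simp
  then have "(\<lambda>n. w (?g n)) \<longlonglongrightarrow> w s"
    by (rule continuous_on_tendsto_compose[OF w]) (use s in auto)
  then show ?thesis unfolding path_val_def by (rule limI)
qed

definition pos_times :: "(real \<Rightarrow> real) \<Rightarrow> real set" where
  "pos_times w = {s. 0 \<le> s \<and> 0 \<le> path_val w s}"

lemma pos_times_borel:
  assumes w: "w \<in> space path_space"
  shows "pos_times w \<in> sets borel"
proof -
  have [measurable]: "(\<lambda>s. path_val w s) \<in> borel_measurable borel"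
    using w by measurable
  have "{s \<in> space borel. 0 \<le> s \<and> 0 \<le> path_val w s} \<in> sets borel"
    by measurable
  then show ?thesis by (simp add: pos_times_def)
qed

lemma measurable_clock_pos_times:
  "(\<lambda>z. clock (pos_times (fst z)) (snd z)) \<in> borel_measurable (path_space \<Otimes>\<^sub>M borel)"
proof -
  let ?N = "path_space \<Otimes>\<^sub>M (borel :: real measure)"
  let ?Q = "{y \<in> space (?N \<Otimes>\<^sub>M lborel). 0 \<le> snd y \<and> snd y \<le> snd (fst y) \<and>
     0 \<le> path_val (fst (fst y)) (snd y)}"
  have "?Q \<in> sets (?N \<Otimes>\<^sub>M lborel)" by measurable
  then have "(\<lambda>z. emeasure lborel (Pair z -` ?Q)) \<in> borel_measurable ?N"
    by (rule lborel.measurable_emeasure_Pair)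
  then have "(\<lambda>z. enn2real (emeasure lborel (Pair z -` ?Q))) \<in> borel_measurable ?N" by simp
  then show ?thesis
  proof (rule measurable_cong[THEN iffD1, rotated])
    fix z assume "z \<in> space ?N"
    then have "Pair z -` ?Q = {0..snd z} \<inter> pos_times (fst z)"
      by (auto simp: pos_times_def space_pair_measure)
    then show "enn2real (emeasure lborel (Pair z -` ?Q)) = clock (pos_times (fst z)) (snd z)"
      by (simp add: clock_def measure_def)
  qed
qed

lemma measurable_clock_pos_times' [measurable (raw)]:
  assumes "f \<in> measurable N path_space" "g \<in> borel_measurable N"
  shows "(\<lambda>z. clock (pos_times (f z)) (g z)) \<in> borel_measurable N"
  using measurable_compose[OF measurable_Pair[OF assms] measurable_clock_pos_times] by simp

lemma measurable_exp_clock_laplace [measurable]: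
  "(\<lambda>w. exp_clock_laplace lam r (pos_times w)) \<in> borel_measurable path_space"
  unfolding exp_clock_laplace_def by measurable

context conservative_regular_diffusion
begin

lemma space_P: "x \<in> I \<Longrightarrow> space (P x) = space \<Omega>"
  using sets_P by (rule sets_eq_imp_space_eq)

lemma measurable_P: "x \<in> I \<Longrightarrow> measurable (P x) N = measurable \<Omega> N"
  using sets_P by (intro measurable_cong_sets) auto

lemma borel_measurable_X:
  assumes "0 \<le> t" shows "X t \<in> borel_measurable \<Omega>"
  using adapted[OF assms] sets_F[of t] space_F[of "ennreal t"]
  by (auto simp: measurable_def)

lemma measurable_traj [measurable]: "traj X \<in> measurable \<Omega> path_space"
  unfolding traj_def by (rule measurable_restrict) (auto intro: borel_measurable_X)

lemma path_val_traj:
  assumes "\<omega> \<in> space \<Omega>" "0 \<le> s"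
  shows "path_val (traj X \<omega>) s = X s \<omega>"
proof -
  have "continuous_on {0..} (traj X \<omega>)"
    using continuous_paths[OF assms(1)] by (subst continuous_on_cong[OF refl]) (auto simp: traj_def)
  from path_val_continuous[OF this assms(2)] show ?thesis
    using assms(2) by (simp add: traj_def)
qed

lemma path_val_traj_from:
  assumes "\<omega> \<in> space \<Omega>" "0 \<le> s"
  shows "path_val (traj_from X \<tau> \<omega>) s = X (enn2real (\<tau> \<omega>) + s) \<omega>"
proof -
  have "continuous_on {0..} (\<lambda>u. X (enn2real (\<tau> \<omega>) + u) \<omega>)"
    by (rule continuous_on_compose2[OF continuous_paths[OF assms(1)]]) (auto intro!: continuous_intros)
  then have "continuous_on {0..} (traj_from X \<tau> \<omega>)"
    by (subst continuous_on_cong[OF refl]) (auto simp: traj_from_def)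
  from path_val_continuous[OF this assms(2)] show ?thesis
    using assms(2) by (simp add: traj_from_def)
qed

lemma measurable_X_random_time:
  assumes "\<sigma> \<in> borel_measurable \<Omega>" "\<And>\<omega>. 0 \<le> \<sigma> \<omega>"
  shows "(\<lambda>\<omega>. X (\<sigma> \<omega>) \<omega>) \<in> borel_measurable \<Omega>"
proof -
  have "(\<lambda>\<omega>. path_val (traj X \<omega>) (\<sigma> \<omega>)) \<in> borel_measurable \<Omega>"
    using assms(1) by measurable
  then show ?thesis
    by (rule measurable_cong[THEN iffD1, rotated]) (simp add: path_val_traj assms(2))
qed

lemma measurable_traj_from:
  assumes "\<tau> \<in> borel_measurable \<Omega>"
  shows "traj_from X \<tau> \<in> measurable \<Omega> path_space"
  unfolding traj_from_def
proof (rule measurable_restrict)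
  fix u :: real assume "u \<in> {0..}"
  then show "(\<lambda>\<omega>. X (enn2real (\<tau> \<omega>) + u) \<omega>) \<in> borel_measurable \<Omega>"
    using assms by (intro measurable_X_random_time) auto
qed

lemma measurable_stopping_time_Omega:
  assumes "stopping_time F \<tau>"
  shows "\<tau> \<in> borel_measurable \<Omega>"
proof (rule borel_measurableI_le)
  fix t
  show "{\<omega> \<in> space \<Omega>. \<tau> \<omega> \<le> t} \<in> sets \<Omega>"
  proof (cases t)
    case (real t')
    then show ?thesis
      using stopping_timeD[OF assms, of t] sets_F[of t'] by (auto simp: pred_def space_F)
  qed simp
qed

definition path_expectation :: "((real \<Rightarrow> real) \<Rightarrow> ennreal) \<Rightarrow> real \<Rightarrow> ennreal" where
  "path_expectation \<Phi> y = (\<integral>\<^sup>+\<omega>. \<Phi> (traj X \<omega>) \<partial>P y)"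

lemma path_expectation_indicator:
  assumes "B \<in> sets path_space" "y \<in> I"
  shows "path_expectation (indicator B) y = emeasure (P y) {\<omega> \<in> space \<Omega>. traj X \<omega> \<in> B}"
proof -
  have "{\<omega> \<in> space \<Omega>. traj X \<omega> \<in> B} \<in> sets (P y)"
    using measurable_sets[OF measurable_traj assms(1)] sets_P[OF assms(2)]
    by (simp add: vimage_def Int_def conj_commute)
  then have "(\<integral>\<^sup>+\<omega>. indicator {\<omega> \<in> space \<Omega>. traj X \<omega> \<in> B} \<omega> \<partial>P y) =
      emeasure (P y) {\<omega> \<in> space \<Omega>. traj X \<omega> \<in> B}"
    by (rule nn_integral_indicator)
  moreover have "path_expectation (indicator B) y =
      (\<integral>\<^sup>+\<omega>. indicator {\<omega> \<in> space \<Omega>. traj X \<omega> \<in> B} \<omega> \<partial>P y)"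
    unfolding path_expectation_def
    by (intro nn_integral_cong) (simp add: space_P[OF assms(2)] indicator_def)
  ultimately show ?thesis by simp
qed

lemma measurable_traj_P: "y \<in> I \<Longrightarrow> \<Phi> \<in> borel_measurable path_space \<Longrightarrow>
    (\<lambda>\<omega>. \<Phi> (traj X \<omega>)) \<in> borel_measurable (P y)"
  unfolding measurable_P by (rule measurable_compose[OF measurable_traj])

lemma path_expectation_simps:
  assumes "y \<in> I"
  shows "u \<in> borel_measurable path_space \<Longrightarrow>
      path_expectation (\<lambda>w. c * u w) y = c * path_expectation u y"
    and "u \<in> borel_measurable path_space \<Longrightarrow> v \<in> borel_measurable path_space \<Longrightarrow>
      path_expectation (\<lambda>w. v w + u w) y = path_expectation v y + path_expectation u y"
    and "(\<And>i. U i \<in> borel_measurable path_space) \<Longrightarrow> incseq U \<Longrightarrow>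
      path_expectation (\<lambda>w. SUP i. U i w) y = (SUP i. path_expectation (U i) y)"
  unfolding path_expectation_def
  by (auto intro!: nn_integral_cmult nn_integral_add nn_integral_monotone_convergence_SUP
      measurable_traj_P assms simp: incseq_def le_fun_def)

lemma path_expectation_mono: "(\<And>w. u w \<le> v w) \<Longrightarrow> path_expectation u y \<le> path_expectation v y"
  unfolding path_expectation_def by (intro nn_integral_mono) auto

lemma path_expectation_cong:
  assumes "\<And>w. w \<in> space path_space \<Longrightarrow> u w = v w" "y \<in> I"
  shows "path_expectation u y = path_expectation v y"
  unfolding path_expectation_def using assms(1) measurable_space[OF measurable_traj]
  by (intro nn_integral_cong) (auto simp: space_P[OF assms(2)])

lemma borel_measurable_on_I_cong:
  assumes "g \<in> borel_measurable (restrict_space borel I)" "\<And>y. y \<in> I \<Longrightarrow> f y = g y"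
  shows "f \<in> borel_measurable (restrict_space borel I)"
  using assms(1) by (rule measurable_cong[THEN iffD2, rotated]) (simp add: assms(2) space_restrict_space)

lemma measurable_path_expectation:
  assumes "\<Phi> \<in> borel_measurable path_space"
  shows "path_expectation \<Phi> \<in> borel_measurable (restrict_space borel I)"
  using assms
proof (induct rule: borel_measurable_induct)
  case (cong f g)
  show ?case
    by (rule borel_measurable_on_I_cong[OF cong(4)]) (rule path_expectation_cong[OF cong(3)])
next
  case (set B)
  show ?case
    by (rule borel_measurable_on_I_cong[OF kernel[OF set]]) (rule path_expectation_indicator[OF set])
next
  case (mult u c)
  show ?case
    by (rule borel_measurable_on_I_cong[OF borel_measurable_times_ennreal[OF borel_measurable_const mult(4)]])
       (rule path_expectation_simps(1)[OF _ mult(2)])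
next
  case (add u v)
  show ?case
    by (rule borel_measurable_on_I_cong[OF borel_measurable_add[OF add(7) add(3)]])
       (rule path_expectation_simps(2)[OF _ add(1) add(4)])
next
  case (seq U)
  have "(\<lambda>y. SUP i. path_expectation (U i) y) \<in> borel_measurable (restrict_space borel I)"
    by (rule borel_measurable_SUP) (auto intro: seq(3))
  then have "path_expectation (\<lambda>w. SUP i. U i w) \<in> borel_measurable (restrict_space borel I)"
    by (rule borel_measurable_on_I_cong) (rule path_expectation_simps(3)[OF _ seq(1) seq(4)])
  moreover have "Sup (range U) = (\<lambda>w. SUP i. U i w)" by (auto simp: fun_eq_iff image_comp)
  ultimately show ?case by (simp only:)
qed

text \<open>
  The strong Markov property is given for indicators of sets of paths; the usual induction extends it
  to nonnegative functionals. The kernel \<open>path_expectation\<close> is only defined sensibly on \<open>I\<close>, hence the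
  constant appeal to \<open>X\<^sub>\<tau> \<in> I\<close>.
\<close>

lemma strong_Markov_functional:
  assumes x: "x \<in> I" and \<tau>: "stopping_time F \<tau>" and A: "A \<in> sets (pre_sigma \<tau>)"
    and \<Phi>: "\<Phi> \<in> borel_measurable path_space"
  shows "(\<integral>\<^sup>+\<omega>\<in>{\<omega> \<in> A. \<tau> \<omega> < \<infinity>}. \<Phi> (traj_from X \<tau> \<omega>) \<partial>P x) =
         (\<integral>\<^sup>+\<omega>\<in>{\<omega> \<in> A. \<tau> \<omega> < \<infinity>}. path_expectation \<Phi> (X (enn2real (\<tau> \<omega>)) \<omega>) \<partial>P x)"
proof -
  let ?C = "{\<omega> \<in> A. \<tau> \<omega> < \<infinity>}"
  have [measurable]: "\<tau> \<in> borel_measurable \<Omega>" using \<tau> by (rule measurable_stopping_time_Omega)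
  \<comment> \<open>\<open>A\<close> itself may only belong to \<open>F \<infinity>\<close>; its part on \<open>\<tau> < \<infinity>\<close> is exhausted by events of finite times.\<close>
  have "?C = (\<Union>n::nat. {\<omega> \<in> A. \<tau> \<omega> \<le> ennreal (real n)})"
    by (auto simp: ennreal_of_nat_eq_real_of_nat[symmetric] intro: le_less_trans[OF _ of_nat_less_top])
       (metis ennreal_Ex_less_of_nat less_imp_le infinity_ennreal_def)
  moreover have "{\<omega> \<in> A. \<tau> \<omega> \<le> ennreal (real n)} \<in> sets \<Omega>" for n
    using sets_pre_sigmaD[OF \<tau> A] sets_F by auto
  ultimately have C[measurable]: "?C \<in> sets \<Omega>" by auto
  then have CP[measurable]: "?C \<in> sets (P x)" by (simp add: sets_P[OF x])
  have Ci[measurable]: "(indicator ?C :: _ \<Rightarrow> ennreal) \<in> borel_measurable (P x)"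
    by (rule borel_measurable_indicator[OF CP])
  have Cs: "\<omega> \<in> space \<Omega>" if "\<omega> \<in> ?C" for \<omega> using that C sets.sets_into_space by blast
  have tf: "traj_from X \<tau> \<in> measurable (P x) path_space"
    unfolding measurable_P[OF x] by (rule measurable_traj_from) measurable
  have tfm: "(\<lambda>\<omega>. \<Psi> (traj_from X \<tau> \<omega>) * indicator ?C \<omega>) \<in> borel_measurable (P x)"
    if "\<Psi> \<in> borel_measurable path_space" for \<Psi> :: "_ \<Rightarrow> ennreal"
    by (rule borel_measurable_times_ennreal[OF measurable_compose[OF tf that] Ci])
  have XI: "X (enn2real (\<tau> \<omega>)) \<omega> \<in> I" if "\<omega> \<in> space \<Omega>" for \<omega>
    by (rule state_space[OF that]) simp
  have Xm: "(\<lambda>\<omega>. X (enn2real (\<tau> \<omega>)) \<omega>) \<in> measurable \<Omega> (restrict_space borel I)"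
    by (rule measurable_restrict_space2) (auto intro!: measurable_X_random_time XI)
  have pm: "(\<lambda>\<omega>. path_expectation \<Psi> (X (enn2real (\<tau> \<omega>)) \<omega>) * indicator ?C \<omega>) \<in> borel_measurable (P x)"
    if "\<Psi> \<in> borel_measurable path_space" for \<Psi>
    using borel_measurable_times_ennreal[OF
        measurable_compose[OF Xm measurable_path_expectation[OF that], folded measurable_P[OF x]] Ci] .
  show ?thesis
    using \<Phi>
  proof (induct rule: borel_measurable_induct)
    case (cong f g)
    have "(\<integral>\<^sup>+\<omega>\<in>?C. f (traj_from X \<tau> \<omega>) \<partial>P x) = (\<integral>\<^sup>+\<omega>\<in>?C. g (traj_from X \<tau> \<omega>) \<partial>P x)"
      using cong(3) measurable_space[OF tf] by (intro nn_integral_cong) auto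
    moreover have "(\<integral>\<^sup>+\<omega>\<in>?C. path_expectation f (X (enn2real (\<tau> \<omega>)) \<omega>) \<partial>P x) =
       (\<integral>\<^sup>+\<omega>\<in>?C. path_expectation g (X (enn2real (\<tau> \<omega>)) \<omega>) \<partial>P x)"
      by (intro nn_integral_cong arg_cong2[where f = "(*)"] path_expectation_cong cong XI)
         (auto simp: space_P[OF x])
    ultimately show ?case using cong(4) by simp
  next
    case (set B)
    have "{\<omega> \<in> A. \<tau> \<omega> < \<infinity> \<and> traj_from X \<tau> \<omega> \<in> B} = ?C \<inter> (traj_from X \<tau> -` B \<inter> space (P x))"
      using Cs by (auto simp: space_P[OF x])
    then have "{\<omega> \<in> A. \<tau> \<omega> < \<infinity> \<and> traj_from X \<tau> \<omega> \<in> B} \<in> sets (P x)"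
      using sets.Int[OF CP measurable_sets[OF tf set]] by (simp only:)
    then have "(\<integral>\<^sup>+\<omega>. indicator {\<omega> \<in> A. \<tau> \<omega> < \<infinity> \<and> traj_from X \<tau> \<omega> \<in> B} \<omega> \<partial>P x) =
      emeasure (P x) {\<omega> \<in> A. \<tau> \<omega> < \<infinity> \<and> traj_from X \<tau> \<omega> \<in> B}"
      by (rule nn_integral_indicator)
    moreover have "(\<integral>\<^sup>+\<omega>\<in>?C. indicator B (traj_from X \<tau> \<omega>) \<partial>P x) =
      (\<integral>\<^sup>+\<omega>. indicator {\<omega> \<in> A. \<tau> \<omega> < \<infinity> \<and> traj_from X \<tau> \<omega> \<in> B} \<omega> \<partial>P x)"
      by (intro nn_integral_cong) (auto simp: indicator_def)
    ultimately have "(\<integral>\<^sup>+\<omega>\<in>?C. indicator B (traj_from X \<tau> \<omega>) \<partial>P x) =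
      emeasure (P x) {\<omega> \<in> A. \<tau> \<omega> < \<infinity> \<and> traj_from X \<tau> \<omega> \<in> B}" by simp
    also have "\<dots> = (\<integral>\<^sup>+\<omega>\<in>?C. emeasure (P (X (enn2real (\<tau> \<omega>)) \<omega>)) {\<omega>' \<in> space \<Omega>. traj X \<omega>' \<in> B} \<partial>P x)"
      by (rule strong_Markov[OF x \<tau> A set])
    also have "\<dots> = (\<integral>\<^sup>+\<omega>\<in>?C. path_expectation (indicator B) (X (enn2real (\<tau> \<omega>)) \<omega>) \<partial>P x)"
      by (intro nn_integral_cong arg_cong2[where f = "(*)"] path_expectation_indicator[symmetric] set XI)
         (auto simp: space_P[OF x])
    finally show ?case .
  next
    case (mult u c)
    have "(\<integral>\<^sup>+\<omega>\<in>?C. path_expectation (\<lambda>w. c * u w) (X (enn2real (\<tau> \<omega>)) \<omega>) \<partial>P x) =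
      (\<integral>\<^sup>+\<omega>. c * (path_expectation u (X (enn2real (\<tau> \<omega>)) \<omega>) * indicator ?C \<omega>) \<partial>P x)"
      by (intro nn_integral_cong) (simp add: path_expectation_simps(1)[OF XI mult(2)] space_P[OF x] mult.assoc)
    also have "\<dots> = c * (\<integral>\<^sup>+\<omega>\<in>?C. path_expectation u (X (enn2real (\<tau> \<omega>)) \<omega>) \<partial>P x)"
      by (rule nn_integral_cmult[OF pm[OF mult(2)]])
    also have "\<dots> = (\<integral>\<^sup>+\<omega>. c * (u (traj_from X \<tau> \<omega>) * indicator ?C \<omega>) \<partial>P x)"
      unfolding mult(4)[symmetric] by (rule nn_integral_cmult[OF tfm[OF mult(2)], symmetric])
    finally show ?case by (simp add: mult.assoc)
  next
    case (add u v)
    have "(\<integral>\<^sup>+\<omega>\<in>?C. path_expectation (\<lambda>w. v w + u w) (X (enn2real (\<tau> \<omega>)) \<omega>) \<partial>P x) =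
      (\<integral>\<^sup>+\<omega>. path_expectation v (X (enn2real (\<tau> \<omega>)) \<omega>) * indicator ?C \<omega> +
        path_expectation u (X (enn2real (\<tau> \<omega>)) \<omega>) * indicator ?C \<omega> \<partial>P x)"
      by (intro nn_integral_cong)
         (simp add: path_expectation_simps(2)[OF XI add(1) add(4)] space_P[OF x] distrib_right)
    also have "\<dots> = (\<integral>\<^sup>+\<omega>\<in>?C. path_expectation v (X (enn2real (\<tau> \<omega>)) \<omega>) \<partial>P x) +
        (\<integral>\<^sup>+\<omega>\<in>?C. path_expectation u (X (enn2real (\<tau> \<omega>)) \<omega>) \<partial>P x)"
      by (rule nn_integral_add[OF pm[OF add(4)] pm[OF add(1)]])
    also have "\<dots> = (\<integral>\<^sup>+\<omega>. v (traj_from X \<tau> \<omega>) * indicator ?C \<omega> + u (traj_from X \<tau> \<omega>) * indicator ?C \<omega> \<partial>P x)"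
      unfolding add(3)[symmetric] add(7)[symmetric]
      by (rule nn_integral_add[OF tfm[OF add(4)] tfm[OF add(1)], symmetric])
    finally show ?case by (simp add: distrib_right)
  next
    case (seq U)
    have U: "Sup (range U) = (\<lambda>w. SUP i. U i w)" by (auto simp: fun_eq_iff image_comp)
    have inc: "incseq (\<lambda>i \<omega>. path_expectation (U i) (X (enn2real (\<tau> \<omega>)) \<omega>) * indicator ?C \<omega>)"
      using seq(4) by (auto simp: incseq_def le_fun_def intro!: mult_right_mono path_expectation_mono)
    have inc': "incseq (\<lambda>i \<omega>. U i (traj_from X \<tau> \<omega>) * indicator ?C \<omega>)"
      using seq(4) by (auto simp: incseq_def le_fun_def intro!: mult_right_mono)
    have "(\<integral>\<^sup>+\<omega>\<in>?C. path_expectation (Sup (range U)) (X (enn2real (\<tau> \<omega>)) \<omega>) \<partial>P x) =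
      (\<integral>\<^sup>+\<omega>. (SUP i. path_expectation (U i) (X (enn2real (\<tau> \<omega>)) \<omega>) * indicator ?C \<omega>) \<partial>P x)"
      unfolding U
      by (intro nn_integral_cong)
         (simp add: path_expectation_simps(3)[OF XI seq(1) seq(4)] space_P[OF x] SUP_mult_right_ennreal)
    also have "\<dots> = (SUP i. \<integral>\<^sup>+\<omega>\<in>?C. path_expectation (U i) (X (enn2real (\<tau> \<omega>)) \<omega>) \<partial>P x)"
      by (rule nn_integral_monotone_convergence_SUP[OF inc pm[OF seq(1)]])
    also have "\<dots> = (SUP i. \<integral>\<^sup>+\<omega>\<in>?C. U i (traj_from X \<tau> \<omega>) \<partial>P x)"
      unfolding seq(3) ..
    also have "\<dots> = (\<integral>\<^sup>+\<omega>. (SUP i. U i (traj_from X \<tau> \<omega>) * indicator ?C \<omega>) \<partial>P x)"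
      by (rule nn_integral_monotone_convergence_SUP[OF inc' tfm[OF seq(1)], symmetric])
    finally show ?case unfolding U by (simp add: SUP_mult_right_ennreal)
  qed
qed

end

section \<open>Strong Markov property at a hitting time\<close>

lemma exp_neg_bounds: "0 \<le> \<mu> \<Longrightarrow> 0 \<le> exp_neg \<mu> h \<and> exp_neg \<mu> h \<le> 1"
  by (auto simp: exp_neg_def)

lemma borel_measurable_exp_neg [measurable]: "exp_neg \<mu> \<in> borel_measurable borel"
  unfolding exp_neg_def[abs_def] by measurable

text \<open>
  Writes \<open>exp_neg\<close> as a mixture of the indicators of \<open>h \<le> s\<close>. The strong Markov property, stated with
  events of the past, can then be weighted with \<open>exp (- \<mu> H)\<close>.
\<close>

lemma exp_neg_layer_cake:
  assumes \<mu>: "0 < \<mu>"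
  shows "ennreal (exp_neg \<mu> h) =
    (\<integral>\<^sup>+s. ennreal (\<mu> * exp (- \<mu> * s)) * indicator {0..} s * indicator {s. h \<le> ennreal s} s \<partial>lborel)"
proof (cases h)
  case (real h')
  have "(\<integral>\<^sup>+s. ennreal (\<mu> * exp (- \<mu> * s)) * indicator {0..} s * indicator {s. h \<le> ennreal s} s \<partial>lborel)
     = (\<integral>\<^sup>+t. ennreal (\<mu> * exp (- \<mu> * t)) * indicator {h'..} t \<partial>lborel)"
    using real by (intro nn_integral_cong) (auto simp: indicator_def ennreal_le_iff)
  then show ?thesis
    using real by (simp add: exp_neg_def nn_integral_exp_tail[OF \<mu>, simplified])
next
  case top
  then have "(\<lambda>s. indicator {s. h \<le> ennreal s} s :: ennreal) = (\<lambda>_. 0)"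
    by (auto simp: indicator_def top_unique)
  then show ?thesis using top by (simp add: exp_neg_def)
qed

context conservative_regular_diffusion
begin

text \<open>
  By continuity the set of hitting times is closed, so the infimum is attained if it is finite.
\<close>

lemma hitting_time_cases:
  assumes \<omega>: "\<omega> \<in> space \<Omega>"
  obtains (never) "hitting_time X y \<omega> = \<infinity>" "\<And>s. 0 \<le> s \<Longrightarrow> X s \<omega> \<noteq> y"
  | (hit) h where "0 \<le> h" "hitting_time X y \<omega> = ennreal h" "X h \<omega> = y"
      "\<And>s. 0 \<le> s \<Longrightarrow> s < h \<Longrightarrow> X s \<omega> \<noteq> y"
proof -
  let ?S = "{s \<in> {0..}. X s \<omega> = y}"
  show thesis
  proof (cases "?S = {}")
    case True
    then have e: "{ennreal t | t. 0 \<le> t \<and> X t \<omega> = y} = {}" by auto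
    have "hitting_time X y \<omega> = \<infinity>"
      unfolding hitting_time_def e by simp
    then show thesis using True by (intro never) auto
  next
    case False
    have "closed ?S"
      using continuous_paths[OF \<omega>] by (intro continuous_closed_preimage_constant) auto
    moreover have bdd: "bdd_below ?S" by (rule bdd_belowI[of _ 0]) auto
    ultimately have h: "Inf ?S \<in> ?S" using False by (intro closed_contains_Inf) auto
    have least: "Inf ?S \<le> s" if "0 \<le> s" "X s \<omega> = y" for s
      using cInf_lower[OF _ bdd, of s] that by auto
    have "hitting_time X y \<omega> = ennreal (Inf ?S)"
      unfolding hitting_time_def
    proof (rule Inf_eqI)
      show "\<And>i. i \<in> {ennreal t | t. 0 \<le> t \<and> X t \<omega> = y} \<Longrightarrow> ennreal (Inf ?S) \<le> i"
        using least by (auto intro!: ennreal_leI)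
      show "\<And>z. (\<And>i. i \<in> {ennreal t | t. 0 \<le> t \<and> X t \<omega> = y} \<Longrightarrow> z \<le> i) \<Longrightarrow> z \<le> ennreal (Inf ?S)"
        using h by auto
    qed
    then show thesis
      using h least by (intro hit[of "Inf ?S"]) force+
  qed
qed

text \<open>
  A continuous path hits \<open>y\<close> in a compact time interval iff it comes arbitrarily close to \<open>y\<close> at
  rational times of that interval. Only countably many \<open>X q\<close> with \<open>q \<le> t\<close> occur on the right,
  which makes the hitting time a stopping time for the filtration as it stands.
\<close>

lemma hitting_time_le_iff:
  assumes \<omega>: "\<omega> \<in> space \<Omega>" and t: "0 \<le> t"
  shows "hitting_time X y \<omega> \<le> ennreal t \<longleftrightarrow>
    (\<forall>n::nat. \<exists>q::rat. (0 \<le> real_of_rat q \<and> real_of_rat q \<le> t) \<and>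
       \<bar>X (real_of_rat q) \<omega> - y\<bar> < 1 / real (Suc n))" (is "_ \<longleftrightarrow> ?R")
proof
  assume le: "hitting_time X y \<omega> \<le> ennreal t"
  obtain s where s: "0 \<le> s" "s \<le> t" "X s \<omega> = y"
    using \<omega>
  proof (cases rule: hitting_time_cases[of _ y])
    case (hit h)
    then show ?thesis using le t that[of h] by auto
  qed (use le in \<open>simp add: top_unique\<close>)
  show ?R
  proof
    fix n
    obtain d where d: "0 < d" "\<And>u. 0 \<le> u \<Longrightarrow> dist u s < d \<Longrightarrow> dist (X u \<omega>) (X s \<omega>) < 1 / real (Suc n)"
      using continuous_paths[OF \<omega>] s(1) unfolding continuous_on_iff
      by (metis atLeast_iff of_nat_0_less_iff zero_less_Suc zero_less_divide_1_iff)
    show "\<exists>q::rat. (0 \<le> real_of_rat q \<and> real_of_rat q \<le> t) \<and> \<bar>X (real_of_rat q) \<omega> - y\<bar> < 1 / real (Suc n)"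
    proof (cases "t = 0")
      case True
      then show ?thesis using s by (intro exI[of _ 0]) auto
    next
      case False
      then have "max 0 (s - d) < min t (s + d)" using s d t by auto
      then obtain q where "max 0 (s - d) < real_of_rat q" "real_of_rat q < min t (s + d)"
        using of_rat_dense by blast
      then show ?thesis
        using d(2)[of "real_of_rat q"] s(3) by (intro exI[of _ q]) (auto simp: dist_real_def)
    qed
  qed
next
  assume R: ?R
  have "continuous_on {0..t} (\<lambda>s. \<bar>X s \<omega> - y\<bar>)"
    by (intro continuous_intros continuous_on_subset[OF continuous_paths[OF \<omega>]]) auto
  then obtain s where s: "s \<in> {0..t}" "\<And>u. u \<in> {0..t} \<Longrightarrow> \<bar>X s \<omega> - y\<bar> \<le> \<bar>X u \<omega> - y\<bar>"
    using continuous_attains_inf[of "{0..t}" "\<lambda>s. \<bar>X s \<omega> - y\<bar>"] t by auto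
  have "X s \<omega> = y"
  proof (rule ccontr)
    assume "X s \<omega> \<noteq> y"
    then obtain n where n: "1 / real (Suc n) < \<bar>X s \<omega> - y\<bar>"
      using reals_Archimedean[of "\<bar>X s \<omega> - y\<bar>"] by (auto simp: inverse_eq_divide)
    from R obtain q :: rat where "0 \<le> real_of_rat q" "real_of_rat q \<le> t"
      "\<bar>X (real_of_rat q) \<omega> - y\<bar> < 1 / real (Suc n)" by blast
    then show False using s(2)[of "real_of_rat q"] n by auto
  qed
  then have "hitting_time X y \<omega> \<le> ennreal s"
    unfolding hitting_time_def using s(1) by (intro Inf_lower) auto
  then show "hitting_time X y \<omega> \<le> ennreal t"
    using s(1) by (auto intro: order_trans ennreal_leI)
qed

lemma stopping_time_hitting_time: "stopping_time F (hitting_time X y)"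
proof
  fix t :: ennreal
  show "Measurable.pred (F t) (\<lambda>\<omega>. hitting_time X y \<omega> \<le> t)"
  proof (cases t)
    case (real t')
    have X[measurable]: "X q \<in> borel_measurable (F t)" if "0 \<le> q" "q \<le> t'" for q
      using adapted[OF that(1)] sets_F_mono[of "ennreal q" t] that real
      by (auto simp: measurable_def space_F)
    have "Measurable.pred (F t) (\<lambda>\<omega>. \<forall>n::nat. \<exists>q::rat. (0 \<le> real_of_rat q \<and> real_of_rat q \<le> t') \<and>
       \<bar>X (real_of_rat q) \<omega> - y\<bar> < 1 / real (Suc n))"
    proof (intro pred_intros_countable)
      fix n :: nat and q :: rat
      show "Measurable.pred (F t) (\<lambda>\<omega>. (0 \<le> real_of_rat q \<and> real_of_rat q \<le> t') \<and>
       \<bar>X (real_of_rat q) \<omega> - y\<bar> < 1 / real (Suc n))"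
      proof (cases "0 \<le> real_of_rat q \<and> real_of_rat q \<le> t'")
        case True
        then have [measurable]: "X (real_of_rat q) \<in> borel_measurable (F t)" by (intro X) auto
        show ?thesis by measurable
      next
        case False
        then have "(\<lambda>\<omega>. (0 \<le> real_of_rat q \<and> real_of_rat q \<le> t') \<and>
          \<bar>X (real_of_rat q) \<omega> - y\<bar> < 1 / real (Suc n)) = (\<lambda>\<omega>. False)" by auto
        then show ?thesis by (simp only:) simp
      qed
    qed
    then show ?thesis
      unfolding real(2)
      by (rule measurable_cong[THEN iffD2, rotated]) (simp add: hitting_time_le_iff real(1) space_F)
  qed simp
qed

lemma measurable_hitting_time [measurable]: "hitting_time X y \<in> borel_measurable \<Omega>"
  by (rule measurable_stopping_time_Omega[OF stopping_time_hitting_time])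

lemma strong_Markov_hitting_time:
  assumes x: "x \<in> I" and \<Phi>: "\<Phi> \<in> borel_measurable path_space"
  shows "(\<integral>\<^sup>+\<omega>. indicator {\<omega> \<in> space \<Omega>. hitting_time X y \<omega> \<le> ennreal s} \<omega> *
           \<Phi> (traj_from X (hitting_time X y) \<omega>) \<partial>P x) =
    path_expectation \<Phi> y * emeasure (P x) {\<omega> \<in> space \<Omega>. hitting_time X y \<omega> \<le> ennreal s}"
proof -
  let ?H = "hitting_time X y"
  let ?A = "{\<omega> \<in> space \<Omega>. ?H \<omega> \<le> ennreal s}"
  have A: "?A \<in> sets (pre_sigma ?H)"
  proof (rule sets_pre_sigmaI[OF stopping_time_hitting_time])
    fix t
    have "{\<omega> \<in> space \<Omega>. ?H \<omega> \<le> min (ennreal s) t} \<in> sets (F (min (ennreal s) t))"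
      using stopping_timeD[OF stopping_time_hitting_time] unfolding pred_def space_F .
    also have "\<dots> \<subseteq> sets (F t)" by (rule sets_F_mono) simp
    also have "{\<omega> \<in> space \<Omega>. ?H \<omega> \<le> min (ennreal s) t} = {\<omega> \<in> ?A. ?H \<omega> \<le> t}" by auto
    finally show "{\<omega> \<in> ?A. ?H \<omega> \<le> t} \<in> sets (F t)" .
  qed
  have C: "{\<omega> \<in> ?A. ?H \<omega> < \<infinity>} = ?A"
    by (auto intro: le_less_trans)
  have As: "?A \<in> sets (P x)" unfolding sets_P[OF x] by measurable
  have "(\<integral>\<^sup>+\<omega>. indicator ?A \<omega> * \<Phi> (traj_from X ?H \<omega>) \<partial>P x) =
     (\<integral>\<^sup>+\<omega>\<in>?A. path_expectation \<Phi> (X (enn2real (?H \<omega>)) \<omega>) \<partial>P x)"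
    using strong_Markov_functional[OF x stopping_time_hitting_time A \<Phi>]
    unfolding C by (simp add: mult.commute)
  also have "\<dots> = (\<integral>\<^sup>+\<omega>. path_expectation \<Phi> y * indicator ?A \<omega> \<partial>P x)"
  proof (rule nn_integral_cong)
    fix \<omega>
    show "path_expectation \<Phi> (X (enn2real (?H \<omega>)) \<omega>) * indicator ?A \<omega> =
      path_expectation \<Phi> y * indicator ?A \<omega>"
    proof (cases "\<omega> \<in> ?A")
      case True
      then have \<omega>: "\<omega> \<in> space \<Omega>" by auto
      from \<omega> have "X (enn2real (?H \<omega>)) \<omega> = y"
        by (cases rule: hitting_time_cases[of _ y]) (use True in \<open>auto simp: top_unique\<close>)
      then show ?thesis by simp
    qed simp
  qed
  also have "\<dots> = path_expectation \<Phi> y * emeasure (P x) ?A"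
    by (rule nn_integral_cmult_indicator[OF As])
  finally show ?thesis .
qed

text \<open>
  At a finite hitting time \<open>X\<close> sits at the deterministic point \<open>y\<close>, so the future after it is
  independent of the time itself, and the expectation factorises. On paths that never reach \<open>y\<close> the
  weight vanishes.
\<close>

lemma strong_Markov_exp_neg:
  assumes x: "x \<in> I" and \<mu>: "0 < \<mu>" and \<Phi>: "\<Phi> \<in> borel_measurable path_space"
  shows "(\<integral>\<^sup>+\<omega>. ennreal (exp_neg \<mu> (hitting_time X y \<omega>)) *
           \<Phi> (traj_from X (hitting_time X y) \<omega>) \<partial>P x) =
    path_expectation \<Phi> y * (\<integral>\<^sup>+\<omega>. ennreal (exp_neg \<mu> (hitting_time X y \<omega>)) \<partial>P x)"
proof -
  let ?H = "hitting_time X y"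
  interpret P: prob_space "P x" by (rule prob_space_P[OF x])
  interpret pair_sigma_finite "P x" lborel ..
  have [measurable_cong]: "sets (P x) = sets \<Omega>" by (rule sets_P[OF x])
  define e where "e s = ennreal (\<mu> * exp (- \<mu> * s)) * indicator {0..} s" for s
  have [measurable]: "e \<in> borel_measurable borel" unfolding e_def by measurable
  have key: "(\<integral>\<^sup>+\<omega>. ennreal (exp_neg \<mu> (?H \<omega>)) * \<Psi> \<omega> \<partial>P x) =
     (\<integral>\<^sup>+s. e s * (\<integral>\<^sup>+\<omega>. indicator {\<omega> \<in> space \<Omega>. ?H \<omega> \<le> ennreal s} \<omega> * \<Psi> \<omega> \<partial>P x) \<partial>lborel)"
    if [measurable]: "\<Psi> \<in> borel_measurable \<Omega>" for \<Psi>
  proof -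
    have ind: "(\<lambda>z. indicator {\<omega> \<in> space \<Omega>. ?H \<omega> \<le> ennreal (snd z)} (fst z) :: ennreal)
      \<in> borel_measurable (P x \<Otimes>\<^sub>M lborel)"
    proof -
      have "(\<lambda>z. if ?H (fst z) \<le> ennreal (snd z) then 1 else 0 :: ennreal)
        \<in> borel_measurable (P x \<Otimes>\<^sub>M lborel)" by measurable
      then show ?thesis
        by (rule measurable_cong[THEN iffD1, rotated])
           (auto simp: space_pair_measure space_P[OF x] indicator_def)
    qed
    have m: "(\<lambda>(\<omega>, s). e s * (indicator {\<omega> \<in> space \<Omega>. ?H \<omega> \<le> ennreal s} \<omega> * \<Psi> \<omega>))
       \<in> borel_measurable (P x \<Otimes>\<^sub>M lborel)"
      unfolding case_prod_beta' using ind by measurable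
    have "(\<integral>\<^sup>+\<omega>. ennreal (exp_neg \<mu> (?H \<omega>)) * \<Psi> \<omega> \<partial>P x) =
      (\<integral>\<^sup>+\<omega>. (\<integral>\<^sup>+s. e s * (indicator {\<omega> \<in> space \<Omega>. ?H \<omega> \<le> ennreal s} \<omega> * \<Psi> \<omega>) \<partial>lborel) \<partial>P x)"
    proof (rule nn_integral_cong)
      fix \<omega> assume "\<omega> \<in> space (P x)"
      then have \<omega>: "\<omega> \<in> space \<Omega>" by (simp add: space_P[OF x])
      have "{s \<in> space lborel. ?H \<omega> \<le> ennreal s} \<in> sets lborel" by measurable
      then have [measurable]: "{s. ?H \<omega> \<le> ennreal s} \<in> sets borel" by simp
      have "ennreal (exp_neg \<mu> (?H \<omega>)) * \<Psi> \<omega> =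
        (\<integral>\<^sup>+s. (e s * indicator {s. ?H \<omega> \<le> ennreal s} s) * \<Psi> \<omega> \<partial>lborel)"
        unfolding exp_neg_layer_cake[OF \<mu>] e_def by (rule nn_integral_multc[symmetric]) measurable
      also have "\<dots> = (\<integral>\<^sup>+s. e s * (indicator {\<omega> \<in> space \<Omega>. ?H \<omega> \<le> ennreal s} \<omega> * \<Psi> \<omega>) \<partial>lborel)"
        using \<omega> by (intro nn_integral_cong) (auto simp: indicator_def)
      finally show "ennreal (exp_neg \<mu> (?H \<omega>)) * \<Psi> \<omega> =
        (\<integral>\<^sup>+s. e s * (indicator {\<omega> \<in> space \<Omega>. ?H \<omega> \<le> ennreal s} \<omega> * \<Psi> \<omega>) \<partial>lborel)" .
    qed
    also have "\<dots> = (\<integral>\<^sup>+s. (\<integral>\<^sup>+\<omega>. e s * (indicator {\<omega> \<in> space \<Omega>. ?H \<omega> \<le> ennreal s} \<omega> * \<Psi> \<omega>) \<partial>P x) \<partial>lborel)"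
      by (rule Fubini'[OF m, symmetric])
    also have "\<dots> = (\<integral>\<^sup>+s. e s * (\<integral>\<^sup>+\<omega>. indicator {\<omega> \<in> space \<Omega>. ?H \<omega> \<le> ennreal s} \<omega> * \<Psi> \<omega> \<partial>P x) \<partial>lborel)"
      by (intro nn_integral_cong nn_integral_cmult) measurable
    finally show ?thesis .
  qed
  have tf: "(\<lambda>\<omega>. \<Phi> (traj_from X ?H \<omega>)) \<in> borel_measurable \<Omega>"
    by (rule measurable_compose[OF measurable_traj_from \<Phi>]) measurable
  have inner: "e s * (\<integral>\<^sup>+\<omega>. indicator {\<omega> \<in> space \<Omega>. ?H \<omega> \<le> ennreal s} \<omega> * \<Phi> (traj_from X ?H \<omega>) \<partial>P x) =
      path_expectation \<Phi> y * (e s * (\<integral>\<^sup>+\<omega>. indicator {\<omega> \<in> space \<Omega>. ?H \<omega> \<le> ennreal s} \<omega> * 1 \<partial>P x))" for s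
  proof -
    have "{\<omega> \<in> space \<Omega>. ?H \<omega> \<le> ennreal s} \<in> sets (P x)" unfolding sets_P[OF x] by measurable
    then have "(\<integral>\<^sup>+\<omega>. indicator {\<omega> \<in> space \<Omega>. ?H \<omega> \<le> ennreal s} \<omega> * 1 \<partial>P x) =
        emeasure (P x) {\<omega> \<in> space \<Omega>. ?H \<omega> \<le> ennreal s}"
      by simp
    then show ?thesis
      unfolding strong_Markov_hitting_time[OF x \<Phi>] by (simp only: mult.left_commute)
  qed
  have em: "(\<lambda>s. e s * (\<integral>\<^sup>+\<omega>. indicator {\<omega> \<in> space \<Omega>. ?H \<omega> \<le> ennreal s} \<omega> * 1 \<partial>P x)) \<in> borel_measurable lborel"
  proof -
    have "(\<lambda>s. \<integral>\<^sup>+\<omega>. (if ?H \<omega> \<le> ennreal s then 1 else 0 :: ennreal) \<partial>P x) \<in> borel_measurable lborel"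
      by measurable
    then have "(\<lambda>s. \<integral>\<^sup>+\<omega>. indicator {\<omega> \<in> space \<Omega>. ?H \<omega> \<le> ennreal s} \<omega> * 1 \<partial>P x) \<in> borel_measurable lborel"
      by (rule measurable_cong[THEN iffD1, rotated])
         (auto intro!: nn_integral_cong simp: space_P[OF x] indicator_def)
    then show ?thesis by measurable
  qed
  show ?thesis
    using key[OF tf] key[of "\<lambda>_. 1"] em by (simp add: inner nn_integral_cmult)
qed

end

section \<open>Occupation time at an independent exponential time\<close>

text \<open>
  Joint law of two independent random variables with values in different types; checked on rectangles.
\<close>

lemma (in prob_space) distr_pair_indep:
  assumes X: "X \<in> measurable M A" and Y: "Y \<in> measurable M B"
    and indep: "indep_set (sets (vimage_algebra (space M) X A)) (sets (vimage_algebra (space M) Y B))"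
  shows "distr M A X \<Otimes>\<^sub>M distr M B Y = distr M (A \<Otimes>\<^sub>M B) (\<lambda>\<omega>. (X \<omega>, Y \<omega>))"
proof (rule pair_measure_eqI)
  interpret X: prob_space "distr M A X" by (rule prob_space_distr[OF X])
  interpret Y: prob_space "distr M B Y" by (rule prob_space_distr[OF Y])
  show "sigma_finite_measure (distr M A X)" "sigma_finite_measure (distr M B Y)" ..
  show "sets (distr M A X \<Otimes>\<^sub>M distr M B Y) = sets (distr M (A \<Otimes>\<^sub>M B) (\<lambda>\<omega>. (X \<omega>, Y \<omega>)))"
    by (simp cong: sets_pair_measure_cong)
  fix a b assume "a \<in> sets (distr M A X)" "b \<in> sets (distr M B Y)"
  then have ab: "a \<in> sets A" "b \<in> sets B" by simp_all
  then have "X -` a \<inter> space M \<in> sets (vimage_algebra (space M) X A)"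
    "Y -` b \<inter> space M \<in> sets (vimage_algebra (space M) Y B)"
    by (auto intro: in_vimage_algebra)
  from indep_setD[OF indep this]
  have "emeasure M (X -` a \<inter> space M) * emeasure M (Y -` b \<inter> space M) =
      emeasure M ((X -` a \<inter> space M) \<inter> (Y -` b \<inter> space M))"
    by (simp add: emeasure_eq_measure ennreal_mult)
  moreover have "(\<lambda>\<omega>. (X \<omega>, Y \<omega>)) -` (a \<times> b) \<inter> space M = (X -` a \<inter> space M) \<inter> (Y -` b \<inter> space M)"
    by auto
  ultimately show "emeasure (distr M A X) a * emeasure (distr M B Y) b =
      emeasure (distr M (A \<Otimes>\<^sub>M B) (\<lambda>\<omega>. (X \<omega>, Y \<omega>))) (a \<times> b)"
    using X Y ab by (simp add: emeasure_distr)
qed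

context conservative_regular_diffusion
begin

lemma pos_times_traj:
  "\<omega> \<in> space \<Omega> \<Longrightarrow> pos_times (traj X \<omega>) = {s. 0 \<le> s \<and> 0 \<le> X s \<omega>}"
  by (auto simp: pos_times_def path_val_traj)

lemma pos_times_traj_borel: "\<omega> \<in> space \<Omega> \<Longrightarrow> pos_times (traj X \<omega>) \<in> sets borel"
  using measurable_space[OF measurable_traj] by (intro pos_times_borel)

lemma pos_times_traj_from:
  "\<omega> \<in> space \<Omega> \<Longrightarrow>
    pos_times (traj_from X \<tau> \<omega>) = shift_set (enn2real (\<tau> \<omega>)) (pos_times (traj X \<omega>))"
  by (auto simp: pos_times_def path_val_traj path_val_traj_from shift_set_def)

lemma occupation_time_eq_clock:
  "\<omega> \<in> space \<Omega> \<Longrightarrow> occupation_time X t \<omega> = clock (pos_times (traj X \<omega>)) t"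
  unfolding occupation_time_def clock_def
  by (intro arg_cong[where f = "measure lborel"]) (auto simp: pos_times_traj)

text \<open>
  The function \<open>u\<close> of the opening text, with the exponential time already integrated out.
\<close>

definition occ_laplace :: "real \<Rightarrow> real \<Rightarrow> real \<Rightarrow> ennreal" where
  "occ_laplace lam r = path_expectation (\<lambda>w. exp_clock_laplace lam r (pos_times w))"

lemma measurable_occ_laplace: "occ_laplace lam r \<in> borel_measurable (restrict_space borel I)"
  unfolding occ_laplace_def by (rule measurable_path_expectation) measurable

lemma occ_laplace_le_1:
  assumes "0 < lam" "0 \<le> r" "x \<in> I"
  shows "occ_laplace lam r x \<le> 1"
proof -
  interpret prob_space "P x" using assms(3) by (rule prob_space_P)
  have "occ_laplace lam r x \<le> (\<integral>\<^sup>+\<omega>. 1 \<partial>P x)"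
    unfolding occ_laplace_def path_expectation_def
    by (intro nn_integral_mono exp_clock_laplace_le_1 assms)
  then show ?thesis by (simp add: emeasure_space_1)
qed

text \<open>
  By independence the joint law of \<open>T\<close> and the trajectory is a product, and integrating over \<open>T\<close> first
  leaves \<open>exp_clock_laplace\<close> of the trajectory.
\<close>

lemma expectation_exp_time:
  assumes x: "x \<in> I" and lam: "0 < lam" and r: "0 \<le> r"
    and T: "distributed (P x) lborel T (exponential_density lam)"
    and indep: "prob_space.indep_set (P x)
           (sets (vimage_algebra (space \<Omega>) T borel))
           (sets (vimage_algebra (space \<Omega>) (traj X) path_space))"
  shows "(\<integral>\<omega>. exp (- r * occupation_time X (T \<omega>) \<omega>) \<partial>P x) = enn2real (occ_laplace lam r x)"
proof -
  interpret P: prob_space "P x" by (rule prob_space_P[OF x])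
  have [measurable_cong]: "sets (P x) = sets \<Omega>" by (rule sets_P[OF x])
  have sp: "space (P x) = space \<Omega>" by (rule space_P[OF x])
  have Tm: "T \<in> measurable (P x) borel" using distributed_measurable[OF T] by simp
  have trm: "traj X \<in> measurable (P x) path_space" by measurable
  have joint: "distr (P x) borel T \<Otimes>\<^sub>M distr (P x) path_space (traj X) =
      distr (P x) (borel \<Otimes>\<^sub>M path_space) (\<lambda>\<omega>. (T \<omega>, traj X \<omega>))"
    by (rule P.distr_pair_indep[OF Tm trm]) (use indep in \<open>simp add: sp\<close>)
  have dT: "distr (P x) borel T = density lborel (exponential_density lam)"
    using distributed_distr_eq_density[OF T] by (simp cong: distr_cong)
  interpret D1: prob_space "distr (P x) borel T" by (rule P.prob_space_distr[OF Tm])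
  interpret D2: prob_space "distr (P x) path_space (traj X)" by (rule P.prob_space_distr[OF trm])
  interpret D: pair_prob_space "distr (P x) borel T" "distr (P x) path_space (traj X)" ..
  have gm: "(\<lambda>z. ennreal (exp (- r * clock (pos_times (snd z)) (fst z))))
      \<in> borel_measurable (borel \<Otimes>\<^sub>M path_space)" by measurable
  have em[measurable]: "(\<lambda>t. exp (- r * clock D t)) \<in> borel_measurable borel" if "D \<in> sets borel" for D
    using that by measurable
  have pm: "(\<lambda>\<omega>. exp (- r * clock (pos_times (traj X \<omega>)) (T \<omega>))) \<in> borel_measurable (P x)"
    using Tm trm by measurable
  have m: "(\<lambda>\<omega>. exp (- r * occupation_time X (T \<omega>) \<omega>)) \<in> borel_measurable (P x)"
    by (rule measurable_cong[THEN iffD2, OF _ pm]) (simp add: occupation_time_eq_clock sp)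
  have "(\<integral>\<^sup>+\<omega>. ennreal (exp (- r * occupation_time X (T \<omega>) \<omega>)) \<partial>P x) =
      (\<integral>\<^sup>+\<omega>. ennreal (exp (- r * clock (pos_times (snd (T \<omega>, traj X \<omega>))) (fst (T \<omega>, traj X \<omega>)))) \<partial>P x)"
    by (intro nn_integral_cong) (simp add: occupation_time_eq_clock sp)
  also have "\<dots> = (\<integral>\<^sup>+z. ennreal (exp (- r * clock (pos_times (snd z)) (fst z)))
      \<partial>distr (P x) (borel \<Otimes>\<^sub>M path_space) (\<lambda>\<omega>. (T \<omega>, traj X \<omega>)))"
    by (subst nn_integral_distr[OF measurable_Pair[OF Tm trm]]) (use gm in simp_all)
  also have "\<dots> = (\<integral>\<^sup>+w. (\<integral>\<^sup>+t. ennreal (exp (- r * clock (pos_times w) t))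
      \<partial>distr (P x) borel T) \<partial>distr (P x) path_space (traj X))"
    unfolding joint[symmetric]
    by (subst D.nn_integral_snd[symmetric]) (use gm in \<open>auto cong: measurable_cong_sets\<close>)
  also have "\<dots> = (\<integral>\<^sup>+w. exp_clock_laplace lam r (pos_times w) \<partial>distr (P x) path_space (traj X))"
  proof (rule nn_integral_cong)
    fix w assume "w \<in> space (distr (P x) path_space (traj X))"
    then have D: "pos_times w \<in> sets borel" by (intro pos_times_borel) simp
    have "(\<integral>\<^sup>+t. ennreal (exp (- r * clock (pos_times w) t)) \<partial>distr (P x) borel T) =
      (\<integral>\<^sup>+t. ennreal (exponential_density lam t) * ennreal (exp (- r * clock (pos_times w) t)) \<partial>lborel)"
      unfolding dT using em[OF D] by (intro nn_integral_density) auto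
    also have "\<dots> = exp_clock_laplace lam r (pos_times w)"
      unfolding exp_clock_laplace_def
      using lam by (intro nn_integral_cong)
        (auto simp: exponential_density_def indicator_def ennreal_mult[symmetric] exp_diff exp_minus
          field_simps)
    finally show "(\<integral>\<^sup>+t. ennreal (exp (- r * clock (pos_times w) t)) \<partial>distr (P x) borel T) =
      exp_clock_laplace lam r (pos_times w)" .
  qed
  also have "\<dots> = occ_laplace lam r x"
    unfolding occ_laplace_def path_expectation_def
    by (subst nn_integral_distr[OF trm]) (simp_all add: measurable_exp_clock_laplace)
  finally show ?thesis
    by (subst integral_eq_nn_integral[OF m]) auto
qed

section \<open>Decomposition at the first passage through zero\<close>

text \<open>
  Up to the hitting time of \<open>0\<close> a path from \<open>x > 0\<close> stays nonnegative by the intermediate value theorem,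
  so the transform splits as in \<open>exp_clock_laplace_full\<close>; the remainder is handled by the strong Markov
  property.
\<close>

lemma first_passage_decomposition:
  assumes x: "x \<in> I" "0 < x" and zero: "0 \<in> I" and lam: "0 < lam" and r: "0 \<le> r"
  shows "enn2real (occ_laplace lam r x) = lam / (lam + r) -
    (lam / (lam + r) - enn2real (occ_laplace lam r 0)) * hitting_laplace P X x (lam + r)"
proof -
  let ?H = "hitting_time X 0" and ?c = "lam / (lam + r)" and ?\<mu> = "lam + r"
  let ?\<Phi> = "\<lambda>w. exp_clock_laplace lam r (pos_times w)"
  interpret P: prob_space "P x" by (rule prob_space_P[OF x(1)])
  have [measurable_cong]: "sets (P x) = sets \<Omega>" by (rule sets_P[OF x(1)])
  have mu: "0 < ?\<mu>" using lam r by simp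
  have c: "0 \<le> ?c" using lam r by simp
  have path: "?\<Phi> (traj X \<omega>) = ennreal (?c * (1 - exp_neg ?\<mu> (?H \<omega>))) +
      ennreal (exp_neg ?\<mu> (?H \<omega>)) * ?\<Phi> (traj_from X ?H \<omega>)"
    if \<omega>: "\<omega> \<in> space \<Omega>" and X0: "X 0 \<omega> = x" for \<omega>
  proof -
    have pos: "0 \<le> X s \<omega>" if s: "0 \<le> s" "\<And>u. 0 \<le> u \<Longrightarrow> u \<le> s \<Longrightarrow> X u \<omega> \<noteq> 0" for s
    proof (rule ccontr)
      assume "\<not> 0 \<le> X s \<omega>"
      moreover have "continuous_on {0..s} (\<lambda>s. X s \<omega>)"
        by (rule continuous_on_subset[OF continuous_paths[OF \<omega>]]) auto
      ultimately obtain u where "0 \<le> u" "u \<le> s" "X u \<omega> = 0"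
        using IVT2'[of "\<lambda>s. X s \<omega>" s 0 0] X0 x(2) s(1) by auto
      then show False using s(2) by blast
    qed
    from \<omega> show ?thesis
    proof (cases rule: hitting_time_cases[of _ 0])
      case never
      have "{0..} \<subseteq> pos_times (traj X \<omega>)"
        unfolding pos_times_traj[OF \<omega>] using never(2) pos by auto
      then show ?thesis
        using exp_clock_laplace_UNIV[OF pos_times_traj_borel[OF \<omega>] _ lam r] never(1)
        by (simp add: exp_neg_def)
    next
      case (hit h)
      have "{0..<h} \<subseteq> pos_times (traj X \<omega>)"
        unfolding pos_times_traj[OF \<omega>] using hit(4) pos by auto
      from exp_clock_laplace_full[OF pos_times_traj_borel[OF \<omega>] hit(1) this lam r]
      show ?thesis
        using hit(1,2) by (simp add: exp_neg_def pos_times_traj_from[OF \<omega>])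
    qed
  qed
  have tf: "(\<lambda>\<omega>. ?\<Phi> (traj_from X ?H \<omega>)) \<in> borel_measurable \<Omega>"
    by (rule measurable_compose[OF measurable_traj_from measurable_exp_clock_laplace]) measurable
  have int: "integrable (P x) (\<lambda>\<omega>. exp_neg ?\<mu> (?H \<omega>))"
    using exp_neg_bounds[of ?\<mu>] mu by (intro P.integrable_const_bound[of _ 1]) auto
  have f: "(\<integral>\<^sup>+\<omega>. ennreal (exp_neg ?\<mu> (?H \<omega>)) \<partial>P x) = ennreal (hitting_laplace P X x ?\<mu>)"
    unfolding hitting_laplace_def
    by (rule nn_integral_eq_integral[OF int]) (use exp_neg_bounds[of ?\<mu>] mu in auto)
  have f0: "0 \<le> hitting_laplace P X x ?\<mu>"
    unfolding hitting_laplace_def using exp_neg_bounds[of ?\<mu>] mu by (intro integral_nonneg_AE) auto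
  have f1: "hitting_laplace P X x ?\<mu> \<le> 1"
    unfolding hitting_laplace_def using exp_neg_bounds[of ?\<mu>] mu int by (intro P.integral_le_const) auto
  have 1: "(\<integral>\<^sup>+\<omega>. ennreal (?c * (1 - exp_neg ?\<mu> (?H \<omega>))) \<partial>P x) = ennreal (?c * (1 - hitting_laplace P X x ?\<mu>))"
  proof (subst nn_integral_eq_integral)
    show "integrable (P x) (\<lambda>\<omega>. ?c * (1 - exp_neg ?\<mu> (?H \<omega>)))" using int by auto
    show "AE \<omega> in P x. 0 \<le> ?c * (1 - exp_neg ?\<mu> (?H \<omega>))"
      using exp_neg_bounds[of ?\<mu>] mu c by (intro always_eventually allI mult_nonneg_nonneg) auto
    show "ennreal (\<integral>\<omega>. ?c * (1 - exp_neg ?\<mu> (?H \<omega>)) \<partial>P x) = ennreal (?c * (1 - hitting_laplace P X x ?\<mu>))"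
      using int by (simp add: hitting_laplace_def P.prob_space)
  qed
  have "occ_laplace lam r x = (\<integral>\<^sup>+\<omega>. ennreal (?c * (1 - exp_neg ?\<mu> (?H \<omega>))) +
      ennreal (exp_neg ?\<mu> (?H \<omega>)) * ?\<Phi> (traj_from X ?H \<omega>) \<partial>P x)"
    unfolding occ_laplace_def path_expectation_def
  proof (rule nn_integral_cong_AE)
    show "AE \<omega> in P x. ?\<Phi> (traj X \<omega>) = ennreal (?c * (1 - exp_neg ?\<mu> (?H \<omega>))) +
      ennreal (exp_neg ?\<mu> (?H \<omega>)) * ?\<Phi> (traj_from X ?H \<omega>)"
      using start[OF x(1)] AE_space
    proof eventually_elim
      case (elim \<omega>)
      then show ?case by (intro path) (simp_all add: space_P[OF x(1)])
    qed
  qed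
  also have "\<dots> = (\<integral>\<^sup>+\<omega>. ennreal (?c * (1 - exp_neg ?\<mu> (?H \<omega>))) \<partial>P x) +
      (\<integral>\<^sup>+\<omega>. ennreal (exp_neg ?\<mu> (?H \<omega>)) * ?\<Phi> (traj_from X ?H \<omega>) \<partial>P x)"
    by (intro nn_integral_add borel_measurable_times_ennreal tf[folded measurable_P[OF x(1)]]) measurable
  also have "\<dots> = ennreal (?c * (1 - hitting_laplace P X x ?\<mu>)) +
      occ_laplace lam r 0 * ennreal (hitting_laplace P X x ?\<mu>)"
    unfolding 1 strong_Markov_exp_neg[OF x(1) mu measurable_exp_clock_laplace] f occ_laplace_def ..
  finally have eq: "occ_laplace lam r x = ennreal (?c * (1 - hitting_laplace P X x ?\<mu>)) +
      occ_laplace lam r 0 * ennreal (hitting_laplace P X x ?\<mu>)" .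
  have fin: "occ_laplace lam r 0 < top"
    using occ_laplace_le_1[OF lam r zero] by (rule le_less_trans) simp
  have "enn2real (occ_laplace lam r x) = ?c * (1 - hitting_laplace P X x ?\<mu>) +
      enn2real (occ_laplace lam r 0) * hitting_laplace P X x ?\<mu>"
  proof -
    have "0 \<le> ?c * (1 - hitting_laplace P X x ?\<mu>)" using c f1 by (intro mult_nonneg_nonneg) auto
    then have "enn2real (ennreal (?c * (1 - hitting_laplace P X x ?\<mu>))) = ?c * (1 - hitting_laplace P X x ?\<mu>)"
      by (rule enn2real_ennreal)
    moreover have "enn2real (occ_laplace lam r 0 * ennreal (hitting_laplace P X x ?\<mu>)) =
        enn2real (occ_laplace lam r 0) * hitting_laplace P X x ?\<mu>"
      using f0 by (simp add: enn2real_mult)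
    moreover have "occ_laplace lam r 0 * ennreal (hitting_laplace P X x ?\<mu>) < top"
      using fin by (simp add: ennreal_mult_less_top)
    ultimately show ?thesis unfolding eq by (subst enn2real_plus) auto
  qed
  then show ?thesis by (simp add: algebra_simps)
qed

lemma hitting_laplace_self:
  assumes zero: "0 \<in> I"
  shows "hitting_laplace P X 0 \<mu> = 1"
proof -
  interpret P: prob_space "P 0" by (rule prob_space_P[OF zero])
  have [measurable_cong]: "sets (P 0) = sets \<Omega>" by (rule sets_P[OF zero])
  have "hitting_laplace P X 0 \<mu> = (\<integral>\<omega>. 1 \<partial>P 0)"
    unfolding hitting_laplace_def
  proof (rule integral_cong_AE)
    show "AE \<omega> in P 0. exp_neg \<mu> (hitting_time X 0 \<omega>) = 1"
      using start[OF zero]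
    proof eventually_elim
      fix \<omega> assume "X 0 \<omega> = 0"
      then have "hitting_time X 0 \<omega> \<le> ennreal 0"
        unfolding hitting_time_def by (intro Inf_lower CollectI exI[of _ 0]) simp
      then show "exp_neg \<mu> (hitting_time X 0 \<omega>) = 1" by (simp add: exp_neg_def)
    qed
  qed measurable
  then show ?thesis by (simp add: P.prob_space)
qed

section \<open>Resolvent equation\<close>

text \<open>
  Both factors on the left are functionals of the path after time \<open>s\<close>, the sign of \<open>X\<^sub>s\<close> being that of
  its value at \<open>0\<close>. Under \<open>P y\<close> this value is almost surely \<open>y\<close>, so it leaves the inner expectation.
\<close>

lemma Markov_occ_laplace:
  assumes x: "x \<in> I" and s: "0 \<le> s"
  shows "(\<integral>\<^sup>+\<omega>. indicator {0..} (X s \<omega>) *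
      exp_clock_laplace lam r (shift_set s (pos_times (traj X \<omega>))) \<partial>P x) =
    (\<integral>\<^sup>+\<omega>. indicator {0..} (X s \<omega>) * occ_laplace lam r (X s \<omega>) \<partial>P x)"
proof -
  let ?\<Phi> = "\<lambda>w. exp_clock_laplace lam r (pos_times w)"
  let ?\<Psi> = "\<lambda>w. indicator {0..} (path_val w 0) * ?\<Phi> w :: ennreal"
  let ?t = "\<lambda>_. ennreal s"
  have st: "stopping_time F ?t" by (rule stopping_time_const)
  have A: "space \<Omega> \<in> sets (pre_sigma ?t)"
    using sets.top[of "pre_sigma ?t"] by (simp add: space_pre_sigma)
  have \<Psi>: "?\<Psi> \<in> borel_measurable path_space" by measurable
  have pe: "path_expectation ?\<Psi> y = indicator {0..} y * occ_laplace lam r y" if y: "y \<in> I" for y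
  proof -
    have "path_expectation ?\<Psi> y = (\<integral>\<^sup>+\<omega>. indicator {0..} y * ?\<Phi> (traj X \<omega>) \<partial>P y)"
      unfolding path_expectation_def
    proof (rule nn_integral_cong_AE)
      show "AE \<omega> in P y. ?\<Psi> (traj X \<omega>) = indicator {0..} y * ?\<Phi> (traj X \<omega>)"
        using start[OF y] AE_space by eventually_elim (simp add: path_val_traj space_P[OF y])
    qed
    also have "\<dots> = indicator {0..} y * occ_laplace lam r y"
      unfolding occ_laplace_def path_expectation_def
      by (intro nn_integral_cmult measurable_traj_P y) measurable
    finally show ?thesis .
  qed
  have "(\<integral>\<^sup>+\<omega>. indicator {0..} (X s \<omega>) *
      exp_clock_laplace lam r (shift_set s (pos_times (traj X \<omega>))) \<partial>P x) =
    (\<integral>\<^sup>+\<omega>\<in>{\<omega> \<in> space \<Omega>. ?t \<omega> < \<infinity>}. ?\<Psi> (traj_from X ?t \<omega>) \<partial>P x)"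
    using s by (intro nn_integral_cong)
      (simp add: space_P[OF x] path_val_traj_from pos_times_traj_from)
  also have "\<dots> = (\<integral>\<^sup>+\<omega>\<in>{\<omega> \<in> space \<Omega>. ?t \<omega> < \<infinity>}. path_expectation ?\<Psi> (X (enn2real (?t \<omega>)) \<omega>) \<partial>P x)"
    by (rule strong_Markov_functional[OF x st A \<Psi>])
  also have "\<dots> = (\<integral>\<^sup>+\<omega>. indicator {0..} (X s \<omega>) * occ_laplace lam r (X s \<omega>) \<partial>P x)"
    using s by (intro nn_integral_cong) (simp add: space_P[OF x] pe state_space)
  finally show ?thesis .
qed

text \<open>
  The expectation of \<open>exp_clock_laplace_perturbation\<close>, with the Markov property at each time \<open>s\<close>.
\<close>

lemma occ_laplace_resolvent_equation:
  assumes x: "x \<in> I" and lam: "0 < lam" and r: "0 \<le> r"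
  shows "occ_laplace lam r x + ennreal r * (\<integral>\<^sup>+s. ennreal (exp (- lam * s)) * (indicator {0..} s *
    (\<integral>\<^sup>+\<omega>. indicator {0..} (X s \<omega>) * occ_laplace lam r (X s \<omega>) \<partial>P x)) \<partial>lborel) = 1"
proof -
  interpret P: prob_space "P x" by (rule prob_space_P[OF x])
  interpret pair_sigma_finite "P x" lborel ..
  have [measurable_cong]: "sets (P x) = sets \<Omega>" by (rule sets_P[OF x])
  have sp: "space (P x) = space \<Omega>" by (rule space_P[OF x])
  let ?D = "\<lambda>\<omega>. pos_times (traj X \<omega>)"
  let ?\<Phi> = "\<lambda>w. exp_clock_laplace lam r (pos_times w)"
  have indm: "(\<lambda>z. indicator {0..} (path_val (traj X (fst z)) (snd z)) * indicator {0..} (snd z) :: ennreal)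
     \<in> borel_measurable (P x \<Otimes>\<^sub>M lborel)" by measurable
  define k where "k \<omega> s = ennreal (exp (- lam * s)) *
       (indicator (?D \<omega> \<inter> {0..}) s * exp_clock_laplace lam r (shift_set s (?D \<omega>)))" for \<omega> s
  \<comment> \<open>In this form, with the clock of the shifted set as an increment, joint measurability is evident.\<close>
  have k_eq: "k \<omega> s = ennreal (exp (- lam * s)) * ((indicator {0..} (path_val (traj X \<omega>) s) * indicator {0..} s) *
      (\<integral>\<^sup>+u. ennreal (lam * exp (- lam * u - r * (clock (?D \<omega>) (s + u) - clock (?D \<omega>) s))) *
        indicator {0..} u \<partial>lborel))" if \<omega>: "\<omega> \<in> space \<Omega>" for \<omega> s
  proof (cases "0 \<le> s")
    case True
    have "(\<integral>\<^sup>+u. ennreal (lam * exp (- lam * u - r * (clock (?D \<omega>) (s + u) - clock (?D \<omega>) s))) *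
        indicator {0..} u \<partial>lborel) = exp_clock_laplace lam r (shift_set s (?D \<omega>))"
      unfolding exp_clock_laplace_def
      by (intro nn_integral_cong)
         (auto simp: indicator_def clock_shift_set[OF pos_times_traj_borel[OF \<omega>] True])
    then show ?thesis
      using True by (auto simp: k_def indicator_def pos_times_def)
  qed (simp add: k_def)
  have km: "case_prod k \<in> borel_measurable (P x \<Otimes>\<^sub>M lborel)"
  proof (rule measurable_cong[THEN iffD2])
    show "case_prod k z = ennreal (exp (- lam * snd z)) *
      ((indicator {0..} (path_val (traj X (fst z)) (snd z)) * indicator {0..} (snd z)) *
      (\<integral>\<^sup>+u. ennreal (lam * exp (- lam * u - r * (clock (?D (fst z)) (snd z + u) - clock (?D (fst z)) (snd z)))) *
        indicator {0..} u \<partial>lborel))" if "z \<in> space (P x \<Otimes>\<^sub>M lborel)" for z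
      unfolding case_prod_beta' by (rule k_eq) (use that in \<open>auto simp: space_pair_measure sp\<close>)
  qed (use indm in measurable)
  have kint: "(\<integral>\<^sup>+\<omega>. k \<omega> s \<partial>P x) = ennreal (exp (- lam * s)) * (indicator {0..} s *
    (\<integral>\<^sup>+\<omega>. indicator {0..} (X s \<omega>) * occ_laplace lam r (X s \<omega>) \<partial>P x))" for s
  proof (cases "0 \<le> s")
    case True
    have [measurable]: "X s \<in> borel_measurable \<Omega>" by (rule borel_measurable_X[OF True])
    have "(\<lambda>\<omega>. ?\<Phi> (traj_from X (\<lambda>_. ennreal s) \<omega>)) \<in> borel_measurable \<Omega>"
      by (rule measurable_compose[OF measurable_traj_from measurable_exp_clock_laplace]) measurable
    then have "(\<lambda>\<omega>. exp_clock_laplace lam r (shift_set s (?D \<omega>))) \<in> borel_measurable \<Omega>"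
      by (rule measurable_cong[THEN iffD1, rotated]) (simp add: pos_times_traj_from True)
    then have m: "(\<lambda>\<omega>. indicator {0..} (X s \<omega>) * exp_clock_laplace lam r (shift_set s (?D \<omega>))) \<in> borel_measurable (P x)"
      by measurable
    have "(\<integral>\<^sup>+\<omega>. k \<omega> s \<partial>P x) = (\<integral>\<^sup>+\<omega>. ennreal (exp (- lam * s)) *
        (indicator {0..} (X s \<omega>) * exp_clock_laplace lam r (shift_set s (?D \<omega>))) \<partial>P x)"
      using True by (intro nn_integral_cong) (auto simp: k_def sp pos_times_traj indicator_def)
    also have "\<dots> = ennreal (exp (- lam * s)) *
        (\<integral>\<^sup>+\<omega>. indicator {0..} (X s \<omega>) * exp_clock_laplace lam r (shift_set s (?D \<omega>)) \<partial>P x)"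
      by (rule nn_integral_cmult[OF m])
    finally show ?thesis
      using True by (simp add: Markov_occ_laplace[OF x True])
  qed (simp add: k_def)
  have im: "(\<lambda>\<omega>. \<integral>\<^sup>+s. k \<omega> s \<partial>lborel) \<in> borel_measurable (P x)"
    using lborel.borel_measurable_nn_integral[OF km] .
  have "1 = (\<integral>\<^sup>+\<omega>. 1 \<partial>P x)" by (simp add: P.emeasure_space_1)
  also have "\<dots> = (\<integral>\<^sup>+\<omega>. ?\<Phi> (traj X \<omega>) + ennreal r * (\<integral>\<^sup>+s. k \<omega> s \<partial>lborel) \<partial>P x)"
    by (intro nn_integral_cong)
       (simp add: k_def sp exp_clock_laplace_perturbation[OF pos_times_traj_borel lam r, simplified])
  also have "\<dots> = occ_laplace lam r x + ennreal r * (\<integral>\<^sup>+\<omega>. (\<integral>\<^sup>+s. k \<omega> s \<partial>lborel) \<partial>P x)"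
    unfolding occ_laplace_def path_expectation_def
    using im by (subst nn_integral_add) (auto simp: nn_integral_cmult)
  also have "(\<integral>\<^sup>+\<omega>. (\<integral>\<^sup>+s. k \<omega> s \<partial>lborel) \<partial>P x) = (\<integral>\<^sup>+s. (\<integral>\<^sup>+\<omega>. k \<omega> s \<partial>P x) \<partial>lborel)"
    by (rule Fubini'[OF km, symmetric])
  finally show ?thesis unfolding kint by simp
qed

end

section \<open>Green kernel\<close>

text \<open>
  Finiteness on compact subintervals is enough: intervals with rational endpoints in \<open>I\<close>, together
  with the endpoints of \<open>I\<close> that belong to \<open>I\<close>, exhaust \<open>I\<close>.
\<close>

lemma sigma_finite_interval:
  assumes int: "is_interval (I :: real set)" and m: "sets m = sets (restrict_space borel I)"
    and fin: "\<And>a b. a \<in> I \<Longrightarrow> b \<in> I \<Longrightarrow> emeasure m {a..b} < \<infinity>"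
  shows "sigma_finite_measure m"
proof
  define Q where "Q = (I \<inter> \<rat>) \<union> {y \<in> I. \<forall>z\<in>I. z \<le> y} \<union> {y \<in> I. \<forall>z\<in>I. y \<le> z}"
  have QI: "Q \<subseteq> I" by (auto simp: Q_def)
  have "countable {y \<in> I. \<forall>z\<in>I. z \<le> y}"
  proof (cases "\<exists>y\<in>I. \<forall>z\<in>I. z \<le> y")
    case True
    then obtain y where "y \<in> I" "\<forall>z\<in>I. z \<le> y" by blast
    then have "{y \<in> I. \<forall>z\<in>I. z \<le> y} \<subseteq> {y}" by (auto intro: antisym)
    then show ?thesis by (rule countable_subset) simp
  qed (auto simp: Collect_empty_eq[THEN iffD2])
  moreover have "countable {y \<in> I. \<forall>z\<in>I. y \<le> z}"
  proof (cases "\<exists>y\<in>I. \<forall>z\<in>I. y \<le> z")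
    case True
    then obtain y where "y \<in> I" "\<forall>z\<in>I. y \<le> z" by blast
    then have "{y \<in> I. \<forall>z\<in>I. y \<le> z} \<subseteq> {y}" by (auto intro: antisym)
    then show ?thesis by (rule countable_subset) simp
  qed (auto simp: Collect_empty_eq[THEN iffD2])
  ultimately have Q: "countable Q"
    unfolding Q_def using countable_rat by (auto intro: countable_subset)
  have sub: "{a..b} \<subseteq> I" if "a \<in> I" "b \<in> I" for a b
    using mem_is_interval_1_I[OF int that] by auto
  have space: "space m = I"
    using sets_eq_imp_space_eq[OF m] by (simp add: space_restrict_space)
  have up: "\<exists>b\<in>Q. y \<le> b" if "y \<in> I" for y
  proof (cases "\<forall>z\<in>I. z \<le> y")
    case False
    then obtain z where "z \<in> I" "y < z" by auto
    then obtain q where "q \<in> \<rat>" "y < q" "q < z" using Rats_dense_in_real by blast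
    then have "q \<in> I" using sub[OF that \<open>z \<in> I\<close>] by auto
    then show ?thesis using \<open>q \<in> \<rat>\<close> \<open>y < q\<close> unfolding Q_def by (intro bexI[of _ q]) auto
  qed (use that in \<open>auto simp: Q_def\<close>)
  have low: "\<exists>a\<in>Q. a \<le> y" if "y \<in> I" for y
  proof (cases "\<forall>z\<in>I. y \<le> z")
    case False
    then obtain z where "z \<in> I" "z < y" by auto
    then obtain q where "q \<in> \<rat>" "z < q" "q < y" using Rats_dense_in_real by blast
    then have "q \<in> I" using sub[OF \<open>z \<in> I\<close> that] by auto
    then show ?thesis using \<open>q \<in> \<rat>\<close> \<open>q < y\<close> unfolding Q_def by (intro bexI[of _ q]) auto
  qed (use that in \<open>auto simp: Q_def\<close>)
  let ?A = "(\<lambda>(a, b). {a..b}) ` (Q \<times> Q)"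
  show "\<exists>A. countable A \<and> A \<subseteq> sets m \<and> \<Union> A = space m \<and> (\<forall>a\<in>A. emeasure m a \<noteq> \<infinity>)"
  proof (intro exI[of _ ?A] conjI)
    show "countable ?A" using Q by auto
    have "{a..b} \<in> sets m" if "a \<in> Q" "b \<in> Q" for a b
    proof -
      have "{a..b} = I \<inter> {a..b}" using sub[of a b] that QI by auto
      then have "{a..b} \<in> (\<inter>) I ` sets borel" by (rule image_eqI) simp
      then show ?thesis unfolding m sets_restrict_space .
    qed
    then show "?A \<subseteq> sets m" by auto
    show "\<Union> ?A = space m"
    proof (intro equalityI subsetI)
      fix y assume "y \<in> \<Union> ?A"
      then show "y \<in> space m" using sub QI unfolding space by blast
    next
      fix y assume "y \<in> space m"
      then obtain a b where "a \<in> Q" "a \<le> y" "b \<in> Q" "y \<le> b"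
        using up low unfolding space by blast
      then show "y \<in> \<Union> ?A" by (intro UnionI[of "{a..b}"]) auto
    qed
    show "\<forall>a\<in>?A. emeasure m a \<noteq> \<infinity>" using fin QI by fastforce
  qed
qed

context conservative_regular_diffusion
begin

lemma borel_measurable_density_section:
  assumes p: "transition_density I P X m p" and m: "sets m = sets (restrict_space borel I)" and x: "x \<in> I"
  shows "(\<lambda>z. indicator {0<..} (fst z) * p (fst z) x (snd z)) \<in> borel_measurable (lborel \<Otimes>\<^sub>M m)"
proof -
  have space: "space m = I"
    using sets_eq_imp_space_eq[OF m] by (simp add: space_restrict_space)
  let ?S = "{0::real<..} \<times> I"
  have S: "?S \<inter> space (lborel \<Otimes>\<^sub>M m) \<in> sets (lborel \<Otimes>\<^sub>M m)"
  proof -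
    have "{0::real<..} \<times> space m \<in> sets (lborel \<Otimes>\<^sub>M m)" by (intro pair_measureI) auto
    then show ?thesis by (simp add: space space_pair_measure Times_Int_Times)
  qed
  have idm: "(\<lambda>y. y) \<in> measurable m borel"
  proof -
    have "(\<lambda>y. y) \<in> measurable (restrict_space borel I) borel" by (rule measurable_restrict_space1) simp
    then show ?thesis by (simp add: measurable_cong_sets[OF m refl])
  qed
  have "(\<lambda>z. (fst z, x, snd z)) \<in> measurable (lborel \<Otimes>\<^sub>M m) (borel \<Otimes>\<^sub>M borel \<Otimes>\<^sub>M borel)"
    by (intro measurable_Pair measurable_const measurable_compose[OF measurable_snd idm]
        measurable_compose[OF measurable_fst]) auto
  then have "(\<lambda>z. (fst z, x, snd z)) \<in> measurable (restrict_space (lborel \<Otimes>\<^sub>M m) ?S) borel"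
    by (intro measurable_restrict_space1) (simp add: borel_prod)
  then have a: "(\<lambda>z. (fst z, x, snd z)) \<in>
      measurable (restrict_space (lborel \<Otimes>\<^sub>M m) ?S) (restrict_space borel ({0<..} \<times> I \<times> I))"
    by (intro measurable_restrict_space2) (auto simp: space_restrict_space x)
  have b: "(\<lambda>(t, x, y). p t x y) \<in> borel_measurable (restrict_space borel ({0<..} \<times> I \<times> I))"
    using p by (simp add: transition_density_def)
  have "(\<lambda>z. p (fst z) x (snd z)) \<in> borel_measurable (restrict_space (lborel \<Otimes>\<^sub>M m) ?S)"
    using measurable_compose[OF a b] by simp
  then have "(\<lambda>z. indicator ?S z *\<^sub>R p (fst z) x (snd z)) \<in> borel_measurable (lborel \<Otimes>\<^sub>M m)"
    by (subst (asm) borel_measurable_restrict_space_iff[OF S])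
  then show ?thesis
    by (rule measurable_cong[THEN iffD1, rotated])
       (auto simp: space space_pair_measure indicator_def)
qed

lemma nn_integral_transition_density:
  assumes p: "transition_density I P X m p" and m: "sets m = sets (restrict_space borel I)"
    and x: "x \<in> I" and s: "0 < s" and g: "g \<in> borel_measurable (restrict_space borel I)"
  shows "(\<integral>\<^sup>+\<omega>. g (X s \<omega>) \<partial>P x) = (\<integral>\<^sup>+y. ennreal (p s x y) * g y \<partial>m)"
proof -
  have Xm: "X s \<in> measurable (P x) (restrict_space borel I)"
    unfolding measurable_P[OF x] using s
    by (intro measurable_restrict_space2 borel_measurable_X) (auto intro: state_space)
  have "(\<lambda>y. indicator {0<..} s * p s x y) \<in> borel_measurable m"
    using measurable_compose[OF measurable_Pair1' borel_measurable_density_section[OF p m x], of s] by simp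
  then have pm: "(\<lambda>y. ennreal (p s x y)) \<in> borel_measurable m"
    using s by simp
  have "distr (P x) (restrict_space borel I) (X s) = density m (\<lambda>y. ennreal (p s x y))"
  proof (rule measure_eqI)
    fix B assume "B \<in> sets (distr (P x) (restrict_space borel I) (X s))"
    then have B: "B \<in> sets (restrict_space borel I)" by simp
    have "emeasure (distr (P x) (restrict_space borel I) (X s)) B =
        emeasure (P x) {\<omega> \<in> space (P x). X s \<omega> \<in> B}"
      by (subst emeasure_distr[OF Xm B]) (intro arg_cong[where f = "emeasure (P x)"], auto)
    also have "\<dots> = (\<integral>\<^sup>+y\<in>B. ennreal (p s x y) \<partial>m)"
      using p s x B unfolding transition_density_def by blast
    also have "\<dots> = emeasure (density m (\<lambda>y. ennreal (p s x y))) B"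
      using B pm m by (subst emeasure_density) auto
    finally show "emeasure (distr (P x) (restrict_space borel I) (X s)) B =
        emeasure (density m (\<lambda>y. ennreal (p s x y))) B" .
  qed (simp add: m)
  then have "(\<integral>\<^sup>+y. g y \<partial>distr (P x) (restrict_space borel I) (X s)) =
      (\<integral>\<^sup>+y. g y \<partial>density m (\<lambda>y. ennreal (p s x y)))" by simp
  then show ?thesis
    using g pm by (simp add: nn_integral_distr[OF Xm] nn_integral_density measurable_cong_sets[OF m refl])
qed

text \<open>
  The Green kernel is the density of the resolvent. Being a Bochner integral, it is \<open>0\<close> where
  the Laplace transform of the transition density diverges; since the process is conservative, the
  extended-valued kernel has total mass \<open>1 / lam\<close>, so this happens on an \<open>m\<close>-null set only.
\<close>

lemma Green_kernel_resolvent: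
  assumes p: "transition_density I P X m p" and m: "sets m = sets (restrict_space borel I)"
    and sf: "sigma_finite_measure m" and x: "x \<in> I" and lam: "0 < lam"
  shows "Green p lam x \<in> borel_measurable m" (is ?meas)
    and "AE y in m. 0 \<le> Green p lam x y" (is ?nonneg)
    and "g \<in> borel_measurable (restrict_space borel I) \<Longrightarrow>
      (\<integral>\<^sup>+s. ennreal (exp (- lam * s)) * (indicator {0..} s * (\<integral>\<^sup>+\<omega>. g (X s \<omega>) \<partial>P x)) \<partial>lborel) =
      (\<integral>\<^sup>+y. ennreal (Green p lam x y) * g y \<partial>m)" (is "_ \<Longrightarrow> ?formula g")
    and "integrable m (Green p lam x)" (is ?int)
proof -
  interpret m: sigma_finite_measure m by (rule sf)
  interpret pair_sigma_finite lborel m ..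
  interpret P: prob_space "P x" by (rule prob_space_P[OF x])
  have space: "space m = I"
    using sets_eq_imp_space_eq[OF m] by (simp add: space_restrict_space)
  have p0: "0 \<le> p t x y" if "0 < t" "y \<in> I" for t y
    using p x that unfolding transition_density_def by blast
  define q where "q t y = indicator {0<..} t * p t x y" for t y
  have q0: "0 \<le> q t y" if "y \<in> I" for t y using p0[of t y] that by (simp add: q_def indicator_def)
  have qm[measurable]: "(\<lambda>z. q (fst z) (snd z)) \<in> borel_measurable (lborel \<Otimes>\<^sub>M m)"
    unfolding q_def by (rule borel_measurable_density_section[OF p m x])
  have qt[measurable]: "(\<lambda>t. q t y) \<in> borel_measurable lborel" if "y \<in> I" for y
    using measurable_compose[OF measurable_Pair2' qm, of y] that by (simp add: space)
  \<comment> \<open>The extended-valued Green kernel, for which Fubini applies.\<close>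
  define G where "G y = (\<integral>\<^sup>+t. ennreal (exp (- lam * t) * q t y) \<partial>lborel)" for y
  have Gm[measurable]: "G \<in> borel_measurable m"
  proof -
    have "(\<lambda>z. ennreal (exp (- lam * fst z) * q (fst z) (snd z))) \<in> borel_measurable (lborel \<Otimes>\<^sub>M m)"
      by measurable
    then have "(\<lambda>z. ennreal (exp (- lam * fst (snd z, fst z)) * q (fst (snd z, fst z)) (snd (snd z, fst z))))
      \<in> borel_measurable (m \<Otimes>\<^sub>M lborel)"
      by (rule measurable_compose[rotated]) measurable
    then show ?thesis
      unfolding G_def using lborel.borel_measurable_nn_integral[of "\<lambda>y t. ennreal (exp (- lam * t) * q t y)" m]
      by (simp add: case_prod_beta')
  qed
  have Green_eq: "Green p lam x y = enn2real (G y)" if y: "y \<in> I" for y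
  proof -
    have "Green p lam x y = (\<integral>t. exp (- lam * t) * q t y \<partial>lborel)"
      unfolding Green_def set_lebesgue_integral_def q_def
      by (intro Bochner_Integration.integral_cong) (auto simp: indicator_def)
    also have "\<dots> = enn2real (G y)"
      unfolding G_def using qt[OF y] q0[OF y] by (intro integral_eq_nn_integral) auto
    finally show ?thesis .
  qed
  have GG: "(\<integral>\<^sup>+s. ennreal (exp (- lam * s)) * (indicator {0..} s * (\<integral>\<^sup>+\<omega>. g (X s \<omega>) \<partial>P x)) \<partial>lborel) =
      (\<integral>\<^sup>+y. G y * g y \<partial>m)" if g: "g \<in> borel_measurable (restrict_space borel I)" for g
  proof -
    have g'[measurable]: "g \<in> borel_measurable m" using g by (simp add: measurable_cong_sets[OF m refl])
    have "(\<integral>\<^sup>+s. ennreal (exp (- lam * s)) * (indicator {0..} s * (\<integral>\<^sup>+\<omega>. g (X s \<omega>) \<partial>P x)) \<partial>lborel) =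
      (\<integral>\<^sup>+s. (\<integral>\<^sup>+y. ennreal (exp (- lam * s) * q s y) * g y \<partial>m) \<partial>lborel)"
    proof (rule nn_integral_cong_AE)
      show "AE s in lborel. ennreal (exp (- lam * s)) * (indicator {0..} s * (\<integral>\<^sup>+\<omega>. g (X s \<omega>) \<partial>P x)) =
        (\<integral>\<^sup>+y. ennreal (exp (- lam * s) * q s y) * g y \<partial>m)"
        using AE_lborel_singleton[of 0]
      proof eventually_elim
        case (elim s)
        show ?case
        proof (cases "0 < s")
          case True
          have "(\<lambda>y. ennreal (q s y)) \<in> borel_measurable m"
            using measurable_compose[OF measurable_Pair1' qm, of s] by simp
          then have "(\<integral>\<^sup>+y. ennreal (exp (- lam * s)) * (ennreal (q s y) * g y) \<partial>m) =
             ennreal (exp (- lam * s)) * (\<integral>\<^sup>+y. ennreal (q s y) * g y \<partial>m)"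
            by (intro nn_integral_cmult borel_measurable_times_ennreal g')
          moreover have "(\<integral>\<^sup>+y. ennreal (exp (- lam * s) * q s y) * g y \<partial>m) =
             (\<integral>\<^sup>+y. ennreal (exp (- lam * s)) * (ennreal (q s y) * g y) \<partial>m)"
            by (intro nn_integral_cong) (simp add: space q0 ennreal_mult mult.assoc)
          moreover have "(\<integral>\<^sup>+y. ennreal (q s y) * g y \<partial>m) = (\<integral>\<^sup>+\<omega>. g (X s \<omega>) \<partial>P x)"
            using nn_integral_transition_density[OF p m x True g] True by (simp add: q_def)
          ultimately show ?thesis using True by simp
        next
          case False
          then have "s < 0" using elim by simp
          then show ?thesis by (simp add: q_def)
        qed
      qed
    qed
    also have "\<dots> = (\<integral>\<^sup>+y. (\<integral>\<^sup>+s. ennreal (exp (- lam * s) * q s y) * g y \<partial>lborel) \<partial>m)"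
      by (rule Fubini'[symmetric]) measurable
    also have "\<dots> = (\<integral>\<^sup>+y. G y * g y \<partial>m)"
      unfolding G_def by (intro nn_integral_cong nn_integral_multc) (auto simp: space intro!: qt)
    finally show ?thesis .
  qed
  have "(\<integral>\<^sup>+y. G y * 1 \<partial>m) =
      (\<integral>\<^sup>+s. ennreal (exp (- lam * s)) * (indicator {0..} s * (\<integral>\<^sup>+\<omega>. 1 \<partial>P x)) \<partial>lborel)"
    by (rule GG[symmetric]) simp
  also have "\<dots> = (\<integral>\<^sup>+s. ennreal (1 / lam) * (ennreal (lam * exp (- lam * s)) * indicator {0..} s) \<partial>lborel)"
    using lam by (intro nn_integral_cong)
      (auto simp: P.emeasure_space_1 indicator_def ennreal_mult[symmetric])
  also have "\<dots> = ennreal (1 / lam)"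
    using nn_integral_exp_density[OF lam] by (subst nn_integral_cmult) auto
  finally have Gint: "(\<integral>\<^sup>+y. G y \<partial>m) = ennreal (1 / lam)" by simp
  then have "AE y in m. G y \<noteq> \<infinity>"
    by (intro nn_integral_PInf_AE) auto
  then have AE_G: "AE y in m. ennreal (Green p lam x y) = G y"
    using AE_space by eventually_elim (simp add: Green_eq space less_top)
  show ?meas
    using borel_measurable_enn2real[OF Gm]
    by (rule measurable_cong[THEN iffD2, rotated]) (simp add: Green_eq space)
  then show ?int
    using AE_G Gint nn_integral_cong_AE[OF AE_G]
    by (intro integrableI_nonneg) (auto simp: Green_eq space intro: AE_I2)
  show ?nonneg by (rule AE_I2) (simp add: Green_eq space)
  show "?formula g" if "g \<in> borel_measurable (restrict_space borel I)"
    unfolding GG[OF that] by (rule nn_integral_cong_AE) (use AE_G in eventually_elim, simp)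
qed

section \<open>The formula at zero\<close>

text \<open>
  The resolvent equation at \<open>0\<close> reads \<open>u 0 + r \<integral> G u = 1\<close>, and \<open>c - u = (c - u 0) f\<close> on \<open>I \<inter> [0, \<infinity>)\<close>.
  Integrating the latter against \<open>G\<close> eliminates \<open>\<integral> G u\<close>; the denominator \<open>1 + r \<integral> G f\<close> is positive.
\<close>

lemma occ_laplace_zero:
  assumes p: "transition_density I P X m p" and m: "sets m = sets (restrict_space borel I)"
    and sf: "sigma_finite_measure m" and zero: "0 \<in> I" and lam: "0 < lam" and r: "0 \<le> r"
  shows "enn2real (occ_laplace lam r 0) =
      1 / (lam + r) *
      (lam + r *
        ((1 - lam * (LINT y:I \<inter> {0..}|m. Green p lam 0 y)) /
         (1 + r * (LINT y:I \<inter> {0..}|m. Green p lam 0 y * hitting_laplace P X y (lam + r)))))"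
proof -
  note G = Green_kernel_resolvent[OF p m sf zero lam]
  let ?G = "Green p lam 0" and ?f = "\<lambda>y. hitting_laplace P X y (lam + r)"
  define u where "u y = enn2real (occ_laplace lam r y)" for y
  define c where "c = lam / (lam + r)"
  define V where "V = I \<inter> {0..}"
  define g where "g = (LINT y:V|m. ?G y)"
  define h where "h = (LINT y:V|m. ?G y * ?f y)"
  have space: "space m = I"
    using sets_eq_imp_space_eq[OF m] by (simp add: space_restrict_space)
  have lr: "0 < lam + r" using lam r by simp
  have Vm[measurable]: "V \<in> sets m" unfolding V_def m sets_restrict_space by auto
  have um: "occ_laplace lam r \<in> borel_measurable (restrict_space borel I)"
    by (rule measurable_occ_laplace)
  then have [measurable]: "occ_laplace lam r \<in> borel_measurable m"
    by (simp add: measurable_cong_sets[OF m refl])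
  then have u_m[measurable]: "u \<in> borel_measurable m" unfolding u_def by measurable
  have u01: "0 \<le> u y" "u y \<le> 1" "ennreal (u y) = occ_laplace lam r y" if "y \<in> I" for y
  proof -
    have 1: "occ_laplace lam r y \<le> 1" by (rule occ_laplace_le_1[OF lam r that])
    show "0 \<le> u y" by (simp add: u_def)
    show "u y \<le> 1" unfolding u_def using enn2real_mono[OF 1] by simp
    show "ennreal (u y) = occ_laplace lam r y"
      unfolding u_def using le_less_trans[OF 1 ennreal_one_less_top] by simp
  qed
  have intG: "integrable m ?G" by (rule G(4))
  have Gm[measurable]: "?G \<in> borel_measurable m" by (rule G(1))
  have intVG: "integrable m (\<lambda>y. indicator V y * ?G y)"
    using integrable_mult_indicator[OF Vm intG] by simp
  have intVGu: "integrable m (\<lambda>y. indicator V y * (?G y * u y))"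
  proof (rule Bochner_Integration.integrable_bound[OF intG])
    show "AE y in m. norm (indicator V y * (?G y * u y)) \<le> norm (?G y)"
      using AE_space
    proof eventually_elim
      case (elim y)
      then have "\<bar>?G y\<bar> * u y \<le> \<bar>?G y\<bar> * 1" using u01[of y] by (intro mult_left_mono) (auto simp: space)
      then show ?case using u01[of y] elim by (auto simp: indicator_def abs_mult space)
    qed
  qed measurable
  have gm: "(\<lambda>y. indicator {0..} y * occ_laplace lam r y) \<in> borel_measurable (restrict_space borel I)"
    by (intro borel_measurable_times_ennreal um measurable_restrict_space1) simp
  have "(\<integral>\<^sup>+y. ennreal (?G y) * (indicator {0..} y * occ_laplace lam r y) \<partial>m) =
     (\<integral>\<^sup>+y. ennreal (indicator V y * (?G y * u y)) \<partial>m)"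
  proof (rule nn_integral_cong_AE)
    show "AE y in m. ennreal (?G y) * (indicator {0..} y * occ_laplace lam r y) =
       ennreal (indicator V y * (?G y * u y))"
      using G(2) AE_space by eventually_elim
        (auto simp: indicator_def V_def space u01 ennreal_mult)
  qed
  also have "\<dots> = ennreal (\<integral>y. indicator V y * (?G y * u y) \<partial>m)"
  proof (rule nn_integral_eq_integral[OF intVGu])
    show "AE y in m. 0 \<le> indicator V y * (?G y * u y)"
      using G(2) AE_space by eventually_elim (auto simp: space u01)
  qed
  finally have "ennreal (u 0) + ennreal r * ennreal (\<integral>y. indicator V y * (?G y * u y) \<partial>m) = 1"
    using occ_laplace_resolvent_equation[OF zero lam r] G(3)[OF gm] by (simp add: u01[OF zero])
  moreover have "0 \<le> (\<integral>y. indicator V y * (?G y * u y) \<partial>m)"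
  proof (rule integral_nonneg_AE)
    show "AE y in m. 0 \<le> indicator V y * (?G y * u y)"
      using G(2) AE_space by eventually_elim (auto simp: space u01)
  qed
  ultimately have "ennreal (u 0 + r * (\<integral>y. indicator V y * (?G y * u y) \<partial>m)) = ennreal 1"
    using r u01(1)[OF zero] by (simp add: ennreal_mult)
  then have eq1: "u 0 + r * (\<integral>y. indicator V y * (?G y * u y) \<partial>m) = 1"
    using r u01(1)[OF zero] \<open>0 \<le> (\<integral>y. indicator V y * (?G y * u y) \<partial>m)\<close>
    by (subst (asm) ennreal_inj) auto
  have fpd: "c - u y = (c - u 0) * ?f y" if "y \<in> V" for y
  proof (cases "y = 0")
    case True
    then show ?thesis by (simp add: hitting_laplace_self[OF zero])
  next
    case False
    then have "y \<in> I" "0 < y" using that by (auto simp: V_def)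
    from first_passage_decomposition[OF this zero lam r] show ?thesis
      unfolding u_def c_def by simp
  qed
  have "c * g - (\<integral>y. indicator V y * (?G y * u y) \<partial>m) =
      (\<integral>y. c * (indicator V y * ?G y) - indicator V y * (?G y * u y) \<partial>m)"
    unfolding g_def set_lebesgue_integral_def using intVG intVGu by simp
  also have "\<dots> = (\<integral>y. (c - u 0) * (indicator V y * (?G y * ?f y)) \<partial>m)"
  proof (intro Bochner_Integration.integral_cong refl)
    fix y
    show "c * (indicator V y * ?G y) - indicator V y * (?G y * u y) = (c - u 0) * (indicator V y * (?G y * ?f y))"
    proof (cases "y \<in> V")
      case True
      have "c * ?G y - ?G y * u y = ?G y * (c - u y)" by (simp add: algebra_simps)
      also have "\<dots> = (c - u 0) * (?G y * ?f y)" unfolding fpd[OF True] by simp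
      finally show ?thesis using True by simp
    qed simp
  qed
  also have "\<dots> = (c - u 0) * h"
    unfolding h_def set_lebesgue_integral_def by simp
  finally have eq2: "(\<integral>y. indicator V y * (?G y * u y) \<partial>m) = c * g - (c - u 0) * h" by simp
  have h0: "0 \<le> h"
    unfolding h_def set_lebesgue_integral_def
  proof (rule integral_nonneg_AE)
    have f0: "0 \<le> ?f y" for y
      unfolding hitting_laplace_def using exp_neg_bounds[of "lam + r"] lr by (intro integral_nonneg_AE) auto
    show "AE y in m. 0 \<le> indicator V y *\<^sub>R (?G y * ?f y)"
      using G(2) by eventually_elim (simp add: f0)
  qed
  have den: "0 < 1 + r * h" using r h0 by (intro add_pos_nonneg) auto
  have "u 0 * (1 + r * h) = 1 - r * c * g + r * c * h"
    using eq1 unfolding eq2 by (simp add: algebra_simps)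
  then have "u 0 = (1 - r * c * g + r * c * h) / (1 + r * h)"
    using den by (simp add: field_simps)
  also have "\<dots> = 1 / (lam + r) * (lam + r * ((1 - lam * g) / (1 + r * h)))"
  proof -
    have c: "(lam + r) * c = lam"
      unfolding c_def using lr by simp
    have "(lam + r) * (1 - r * c * g + r * c * h) =
        (lam + r) - r * ((lam + r) * c) * g + r * ((lam + r) * c) * h"
      by (simp add: algebra_simps)
    also have "\<dots> = lam * (1 + r * h) + r * (1 - lam * g)"
      unfolding c by (simp add: algebra_simps)
    finally have "(1 - r * c * g + r * c * h) = (lam * (1 + r * h) + r * (1 - lam * g)) / (lam + r)"
      using lr by (simp add: field_simps)
    then show ?thesis using den lr by (simp add: add_divide_distrib)
  qed
  finally show ?thesis unfolding u_def g_def h_def V_def .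
qed

end

theorem theorem4p1:
  fixes \<Omega> :: "'w measure" and F :: "ennreal \<Rightarrow> 'w measure" and I :: "real set"
    and P :: "real \<Rightarrow> 'w measure" and X :: "real \<Rightarrow> 'w \<Rightarrow> real"
    and S :: "real \<Rightarrow> real" and m :: "real measure" and p :: "real \<Rightarrow> real \<Rightarrow> real \<Rightarrow> real"
    and T :: "'w \<Rightarrow> real" and lam r :: real
  assumes "conservative_regular_diffusion \<Omega> F I P X"
    and "0 \<in> I"
    and "scale_function I P X S" and "S 0 = 0"
    and "speed_measure I P X S m"
    and "transition_density I P X m p"
    and "lam > 0" and "r \<ge> 0"
    and "\<And>x. x \<in> I \<Longrightarrow> distributed (P x) lborel T (exponential_density lam)"
    and "\<And>x. x \<in> I \<Longrightarrow> prob_space.indep_set (P x)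
           (sets (vimage_algebra (space \<Omega>) T borel))
           (sets (vimage_algebra (space \<Omega>) (traj X) path_space))"
  shows "(\<forall>x\<in>I. x > 0 \<longrightarrow>
      (\<integral>\<omega>. exp (- r * occupation_time X (T \<omega>) \<omega>) \<partial>P x) =
      lam / (lam + r) -
      (lam / (lam + r) - (\<integral>\<omega>. exp (- r * occupation_time X (T \<omega>) \<omega>) \<partial>P 0)) *
      (\<integral>\<omega>. exp_neg (lam + r) (hitting_time X 0 \<omega>) \<partial>P x)) \<and>
    (\<integral>\<omega>. exp (- r * occupation_time X (T \<omega>) \<omega>) \<partial>P 0) =
      1 / (lam + r) *
      (lam + r *
        ((1 - lam * (LINT y:I \<inter> {0..}|m. Green p lam 0 y)) /
         (1 + r * (LINT y:I \<inter> {0..}|m. Green p lam 0 y * hitting_laplace P X y (lam + r)))))"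
proof -
  interpret conservative_regular_diffusion \<Omega> F I P X by fact
  have m: "sets m = sets (restrict_space borel I)"
    and fin: "\<And>a b. a \<in> I \<Longrightarrow> b \<in> I \<Longrightarrow> emeasure m {a..b} < \<infinity>"
    using assms(5) unfolding speed_measure_def by blast+
  have "sigma_finite_measure m" by (rule sigma_finite_interval[OF interval m fin])
  note zero = occ_laplace_zero[OF assms(6) m this assms(2,7,8)]
  have E: "(\<integral>\<omega>. exp (- r * occupation_time X (T \<omega>) \<omega>) \<partial>P x) = enn2real (occ_laplace lam r x)"
    if "x \<in> I" for x
    by (rule expectation_exp_time[OF that assms(7,8) assms(9)[OF that] assms(10)[OF that]])
  show ?thesis
    unfolding E[OF assms(2)]
  proof (intro conjI ballI impI)
    fix x assume x: "x \<in> I" "0 < x"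
    show "(\<integral>\<omega>. exp (- r * occupation_time X (T \<omega>) \<omega>) \<partial>P x) =
      lam / (lam + r) - (lam / (lam + r) - enn2real (occ_laplace lam r 0)) *
      (\<integral>\<omega>. exp_neg (lam + r) (hitting_time X 0 \<omega>) \<partial>P x)"
      using first_passage_decomposition[OF x assms(2,7,8)]
      unfolding E[OF x(1)] hitting_laplace_def .
  qed (rule zero)
qed

end
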